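(* Let $\lambda\in(0,1]$, $n\in\mathbb{N}$ and $T\in\mathbb{B}(\mathcal{H})$. Then $T$ is $n$-power quasinormal if and only if $(\Delta_{\lambda}(T))^n=T^n$.
   Context: $\mathbb{N}$ denotes the positive integers. $\mathbb{B}(\mathcal{H})$ is the algebra of bounded linear operators on a complex Hilbert space $\mathcal{H}$. $T$ is $n$-power quasinormal if $T^n(T^*T)=(T^*T)T^n$. $|T|=(T^*T)^{1/2}$. Let $T=U|T|$ be the polar decomposition of $T$ ($U$ the partial isometry with $\ker U=\ker |T|$). For $\lambda\in[0,1]$ the $\lambda$-Aluthge transform of $T$ is $\Delta_{\lambda}(T)=|T|^{\lambda}U|T|^{1-\lambda}$, where $|T|^0=I$; in particular $\Delta_0(T)=T$ and $\Delta_1(T)=|T|U$. *)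

theory Defs
  imports "HOL-Analysis.Analysis" "HOL-Computational_Algebra.Polynomial"
begin

class complex_vector = real_vector +
  fixes scaleC :: "complex \<Rightarrow> 'a \<Rightarrow> 'a" (infixr "*\<^sub>C" 75)
  assumes scaleC_add_right: "a *\<^sub>C (x + y) = a *\<^sub>C x + a *\<^sub>C y"
    and scaleC_add_left: "(a + b) *\<^sub>C x = a *\<^sub>C x + b *\<^sub>C x"
    and scaleC_scaleC: "a *\<^sub>C b *\<^sub>C x = (a * b) *\<^sub>C x"
    and scaleR_scaleC: "scaleR r x = complex_of_real r *\<^sub>C x"

text \<open>The inner product is linear in the first argument. Positive definiteness is contained in
  the axiom relating it to the norm, and completeness in the class \<open>banach\<close>.\<close>

class complex_hilbert = complex_vector + banach +
  fixes cinner :: "'a \<Rightarrow> 'a \<Rightarrow> complex"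
  assumes cinner_commute: "cinner x y = cnj (cinner y x)"
    and cinner_add_left: "cinner (x + y) z = cinner x z + cinner y z"
    and cinner_scaleC_left: "cinner (c *\<^sub>C x) y = c * cinner x y"
    and cinner_self: "cinner x x = complex_of_real ((norm x)\<^sup>2)"

instantiation complex :: complex_hilbert
begin

definition scaleC_complex :: "complex \<Rightarrow> complex \<Rightarrow> complex"
  where "scaleC_complex c x = c * x"

definition cinner_complex :: "complex \<Rightarrow> complex \<Rightarrow> complex"
  where "cinner_complex x y = x * cnj y"

instance
proof
  fix x :: complex
  show "cinner x x = complex_of_real ((norm x)\<^sup>2)"
    unfolding cinner_complex_def by (rule complex_norm_square [symmetric])
qed (simp_all add: scaleC_complex_def cinner_complex_def algebra_simps scaleR_conv_of_real)

end

text \<open>Elements of \<open>'a \<Rightarrow>\<^sub>L 'a\<close> are only real-linear; the algebra of bounded operators on the complex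
  Hilbert space \<open>'a\<close> consists of those satisfying the following predicate.\<close>

definition clinear_op :: "('a::complex_hilbert \<Rightarrow>\<^sub>L 'a) \<Rightarrow> bool"
  where "clinear_op T \<longleftrightarrow> (\<forall>c x. T (c *\<^sub>C x) = c *\<^sub>C T x)"

primrec op_power :: "('a::real_normed_vector \<Rightarrow>\<^sub>L 'a) \<Rightarrow> nat \<Rightarrow> ('a \<Rightarrow>\<^sub>L 'a)"
  where
    "op_power T 0 = id_blinfun"
  | "op_power T (Suc n) = T o\<^sub>L op_power T n"

definition op_adj :: "('a::complex_hilbert \<Rightarrow>\<^sub>L 'a) \<Rightarrow> ('a \<Rightarrow>\<^sub>L 'a)"
  where "op_adj T = (THE S. clinear_op S \<and> (\<forall>x y. cinner (T x) y = cinner x (S y)))"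

definition n_power_quasinormal :: "nat \<Rightarrow> ('a::complex_hilbert \<Rightarrow>\<^sub>L 'a) \<Rightarrow> bool"
  where "n_power_quasinormal n T \<longleftrightarrow>
    op_power T n o\<^sub>L (op_adj T o\<^sub>L T) = (op_adj T o\<^sub>L T) o\<^sub>L op_power T n"

definition op_spectrum :: "('a::complex_hilbert \<Rightarrow>\<^sub>L 'a) \<Rightarrow> complex set"
  where "op_spectrum A = {z. \<not> (\<exists>B :: 'a \<Rightarrow>\<^sub>L 'a. clinear_op B \<and>
    (\<forall>x. B (A x - z *\<^sub>C x) = x) \<and> (\<forall>x. A (B x) - z *\<^sub>C B x = x))}"

definition op_poly :: "real poly \<Rightarrow> ('a::real_normed_vector \<Rightarrow>\<^sub>L 'a) \<Rightarrow> ('a \<Rightarrow>\<^sub>L 'a)"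
  where "op_poly p A = (\<Sum>i\<le>degree p. coeff p i *\<^sub>R op_power A i)"

text \<open>Continuous functional calculus of a self-adjoint operator \<open>A\<close> (whose spectrum is real), for a
  real function \<open>f\<close> continuous on the spectrum: \<open>f(A)\<close> is the operator-norm limit of \<open>p\<^sub>k(A)\<close> whenever
  the real polynomials \<open>p\<^sub>k\<close> converge to \<open>f\<close> uniformly on the spectrum of \<open>A\<close>. It is
  independent of the choice of the approximating sequence.\<close>

definition fun_calc :: "(real \<Rightarrow> real) \<Rightarrow> ('a::complex_hilbert \<Rightarrow>\<^sub>L 'a) \<Rightarrow> ('a \<Rightarrow>\<^sub>L 'a)"
  where "fun_calc f A = (THE B. \<exists>p :: nat \<Rightarrow> real poly.
    uniform_limit {t. complex_of_real t \<in> op_spectrum A} (\<lambda>k. poly (p k)) f sequentially \<and>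
    (\<lambda>k. op_poly (p k) A) \<longlonglongrightarrow> B)"

text \<open>Real powers, with exponent at least \<open>0\<close>, of a positive operator. Since \<open>0 powr 0 = 0\<close>, the
  exponent \<open>0\<close> is treated separately, so that the zeroth power is the identity.\<close>

definition op_powr :: "('a::complex_hilbert \<Rightarrow>\<^sub>L 'a) \<Rightarrow> real \<Rightarrow> ('a \<Rightarrow>\<^sub>L 'a)"
  where "op_powr A r = fun_calc (\<lambda>t. if r = 0 then 1 else t powr r) A"

definition op_abs :: "('a::complex_hilbert \<Rightarrow>\<^sub>L 'a) \<Rightarrow> ('a \<Rightarrow>\<^sub>L 'a)"
  where "op_abs T = op_powr (op_adj T o\<^sub>L T) (1 / 2)"

definition op_ker :: "('a::complex_hilbert \<Rightarrow>\<^sub>L 'a) \<Rightarrow> 'a set"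
  where "op_ker T = {x. T x = 0}"

definition partial_isometry :: "('a::complex_hilbert \<Rightarrow>\<^sub>L 'a) \<Rightarrow> bool"
  where "partial_isometry U \<longleftrightarrow> clinear_op U \<and>
    (\<forall>x. (\<forall>y\<in>op_ker U. cinner x y = 0) \<longrightarrow> norm (U x) = norm x)"

definition polar_isometry :: "('a::complex_hilbert \<Rightarrow>\<^sub>L 'a) \<Rightarrow> ('a \<Rightarrow>\<^sub>L 'a)"
  where "polar_isometry T = (THE U. partial_isometry U \<and> T = U o\<^sub>L op_abs T \<and>
    op_ker U = op_ker (op_abs T))"

definition aluthge :: "real \<Rightarrow> ('a::complex_hilbert \<Rightarrow>\<^sub>L 'a) \<Rightarrow> ('a \<Rightarrow>\<^sub>L 'a)"
  where "aluthge l T = op_powr (op_abs T) l o\<^sub>L polar_isometry T o\<^sub>L op_powr (op_abs T) (1 - l)"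

end

theory Submission
  imports Defs "HOL-Computational_Algebra.Fundamental_Theorem_Algebra"
begin

text \<open>Write \<open>A\<close> for the modulus \<open>|T|\<close>, \<open>T = U A\<close> for the polar decomposition and
  \<open>D = A\<^sup>l U A\<^sup>1\<^sup>-\<^sup>l\<close> for the transform. Everything rests on the identity \<open>D A\<^sup>l = A\<^sup>l T\<close>
  (\<open>aluthge_intertwine\<close>), which iterates to \<open>D\<^sup>n A\<^sup>l = A\<^sup>l T\<^sup>n\<close>.

  If \<open>T\<^sup>n\<close> commutes with \<open>T\<^sup>*T = A\<^sup>2\<close>, it commutes with \<open>A\<close>, a limit of polynomials in \<open>A\<^sup>2\<close>,
  and likewise with \<open>A\<^sup>l\<close>, a limit of polynomials in \<open>A\<close>. So \<open>D\<^sup>n A\<^sup>l = T\<^sup>n A\<^sup>l\<close>, and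
  multiplying by \<open>A\<^sup>1\<^sup>-\<^sup>l\<close> gives \<open>D\<^sup>n A = T\<^sup>n A\<close>. Hence \<open>D\<^sup>n\<close> and \<open>T\<^sup>n\<close> agree on the closure of
  the range of \<open>A\<close>. On its orthogonal complement, the kernel of \<open>A\<close>, both vanish, since \<open>D\<close> and
  \<open>T\<close> do and \<open>n\<close> is positive (\<open>aluthge_kernel\<close>). Two operators that agree on both parts are
  equal (\<open>eq_on_range_and_kernel_imp_eq\<close>).

  Conversely, if \<open>D\<^sup>n = T\<^sup>n\<close>, then \<open>T\<^sup>n\<close> commutes with \<open>A\<^sup>l\<close>. As \<open>l\<close> is positive, \<open>A\<close> is a limit
  of polynomials in \<open>A\<^sup>l\<close>, so \<open>T\<^sup>n\<close> commutes with \<open>A\<close> (\<open>commute_if_commute_op_powr\<close>) and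
  therefore with \<open>A\<^sup>2\<close>.

  Most of the development shows that the operators involved exist and are determined by their
  descriptions. Adjoints come from the Riesz representation theorem. For the functional calculus
  the key fact is the bound \<open>\<parallel>p(A)\<parallel> \<le> sup |p|\<close> over the real spectrum of a self-adjoint \<open>A\<close>
  (\<open>norm_op_poly_le\<close>): one of \<open>\<plusminus>\<parallel>p(A)\<parallel>\<close>, say \<open>s\<close>, is an approximate eigenvalue of \<open>p(A)\<close> (unless
  the space is zero), and factoring \<open>p - s\<close> into real linear and quadratic factors yields a root
  \<open>t\<close> of \<open>p - s\<close> in the spectrum of \<open>A\<close>. The partial isometry \<open>U\<close> is the extension of
  \<open>A x \<mapsto> T x\<close> to the closure of the range of \<open>A\<close>, continued by \<open>0\<close> on the kernel.\<close>

section \<open>Inner products and orthogonal projections\<close>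

lemma scaleC_minus_one: "(-1) *\<^sub>C x = - (x::'a::complex_vector)"
  using scaleR_scaleC[of "-1" x] by simp

lemma cinner_add_right: "cinner (x::'a::complex_hilbert) (y + z) = cinner x y + cinner x z"
  by (metis cinner_add_left cinner_commute complex_cnj_add)

lemma cinner_scaleC_right: "cinner (x::'a::complex_hilbert) (c *\<^sub>C y) = cnj c * cinner x y"
  by (metis cinner_scaleC_left cinner_commute complex_cnj_mult)

lemma cinner_scaleR_left: "cinner (r *\<^sub>R x) (y::'a::complex_hilbert) = r *\<^sub>R cinner x y"
  by (simp only: scaleR_scaleC[of r x] cinner_scaleC_left scaleR_conv_of_real)

lemma cinner_scaleR_right: "cinner x (r *\<^sub>R (y::'a::complex_hilbert)) = r *\<^sub>R cinner x y"
  by (simp only: scaleR_scaleC[of r y] cinner_scaleC_right scaleR_conv_of_real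
      complex_cnj_complex_of_real)

lemma norm_scaleC: "norm (c *\<^sub>C x) = cmod c * norm (x::'a::complex_hilbert)"
proof -
  have "complex_of_real ((norm (c *\<^sub>C x))\<^sup>2) = c * cnj c * cinner x x"
    by (simp only: cinner_self[symmetric] cinner_scaleC_left cinner_scaleC_right
        mult.assoc mult.left_commute)
  also have "\<dots> = complex_of_real ((cmod c * norm x)\<^sup>2)"
    by (simp only: cinner_self complex_norm_square[symmetric] power_mult_distrib of_real_mult)
  finally have "(norm (c *\<^sub>C x))\<^sup>2 = (cmod c * norm x)\<^sup>2"
    using of_real_eq_iff by blast
  then show ?thesis
    by (simp add: power2_eq_iff_nonneg)
qed

lemma norm_add_sq:
  "(norm (x + y))\<^sup>2 = (norm x)\<^sup>2 + (norm y)\<^sup>2 + 2 * Re (cinner x (y::'a::complex_hilbert))"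
proof -
  have "complex_of_real ((norm (x + y))\<^sup>2)
      = cinner x x + cinner y y + (cinner x y + cnj (cinner x y))"
    by (simp only: cinner_self[symmetric] cinner_add_left cinner_add_right cinner_commute[of y x])
      simp
  also have "\<dots> = complex_of_real ((norm x)\<^sup>2 + (norm y)\<^sup>2 + 2 * Re (cinner x y))"
    by (simp add: cinner_self complex_add_cnj)
  finally show ?thesis
    using of_real_eq_iff by blast
qed

lemma cinner_minus_right: "cinner x (- y) = - cinner x (y::'a::complex_hilbert)"
  using cinner_scaleR_right[of x "-1" y] by simp

lemma norm_diff_sq:
  "(norm (x - y))\<^sup>2 = (norm x)\<^sup>2 + (norm y)\<^sup>2 - 2 * Re (cinner x (y::'a::complex_hilbert))"
  using norm_add_sq[of x "- y"] by (simp add: cinner_minus_right)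

lemma Cauchy_Schwarz_cinner: "cmod (cinner x y) \<le> norm x * norm (y::'a::complex_hilbert)"
proof (cases "y = 0")
  case True
  then show ?thesis
    using cinner_scaleR_right[of x 0 y] by simp
next
  case False
  let ?a = "(norm y)\<^sup>2" and ?z = "cinner x y"
  have a: "?a > 0" using False by simp
  have z: "cnj ?z * ?z = complex_of_real ((cmod ?z)\<^sup>2)"
    by (metis complex_norm_square mult.commute)
  have c: "cinner (?a *\<^sub>R x) (?z *\<^sub>C y) = complex_of_real (?a * (cmod ?z)\<^sup>2)"
    unfolding cinner_scaleC_right
    by (simp only: cinner_scaleR_left z[symmetric] scaleR_conv_of_real of_real_mult
        mult.left_commute)
  have "0 \<le> (norm (?a *\<^sub>R x - ?z *\<^sub>C y))\<^sup>2" by simp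
  also have "\<dots> = (?a * norm x)\<^sup>2 + (cmod ?z)\<^sup>2 * ?a - 2 * (?a * (cmod ?z)\<^sup>2)"
    unfolding norm_diff_sq c by (simp add: norm_scaleC power_mult_distrib)
  also have "\<dots> = ?a * ((norm x * norm y)\<^sup>2 - (cmod ?z)\<^sup>2)"
    by (simp add: algebra_simps power2_eq_square)
  finally have "(cmod ?z)\<^sup>2 \<le> (norm x * norm y)\<^sup>2"
    using a by (simp add: zero_le_mult_iff)
  then show ?thesis
    by (rule power2_le_imp_le) simp
qed

lemma bounded_bilinear_cinner:
  "bounded_bilinear (cinner :: 'a::complex_hilbert \<Rightarrow> 'a \<Rightarrow> complex)"
proof
  show "\<exists>K. \<forall>a b::'a. norm (cinner a b) \<le> norm a * norm b * K"
    by (intro exI[of _ 1]) (simp add: Cauchy_Schwarz_cinner)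
qed (simp_all add: cinner_add_left cinner_add_right cinner_scaleR_left cinner_scaleR_right)

interpretation cinner: bounded_bilinear "cinner :: 'a::complex_hilbert \<Rightarrow> 'a \<Rightarrow> complex"
  by (rule bounded_bilinear_cinner)

lemma cinner_eq_zero_commute: "cinner x y = 0 \<longleftrightarrow> cinner y (x::'a::complex_hilbert) = 0"
  by (metis cinner_commute complex_cnj_zero)

lemma cinner_self_zero [simp]: "cinner x x = 0 \<longleftrightarrow> x = (0::'a::complex_hilbert)"
  by (simp add: cinner_self)

text \<open>Since \<open>complex\<close> is itself a \<open>complex_hilbert\<close> type, a goal produced by this rule matches
  it again, so \<open>rule\<close> is the method to apply it with, not \<open>intro\<close>.\<close>

lemma cinner_ext:
  assumes "\<And>z. cinner x z = cinner (y::'a::complex_hilbert) z"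
  shows "x = y"
  using assms[of "x - y"] cinner_self_zero[of "x - y"] unfolding cinner.diff_left by simp

text \<open>The parallelogram law for \<open>x - u\<close> and \<open>x - v\<close>, written with the midpoint of \<open>u\<close> and \<open>v\<close>.
  It makes a minimizing sequence for the distance from \<open>x\<close> to a subspace Cauchy.\<close>

lemma parallelogram_midpoint:
  fixes x u v :: "'a::complex_hilbert"
  shows "(norm (u - v))\<^sup>2
    = 2 * (norm (x - u))\<^sup>2 + 2 * (norm (x - v))\<^sup>2 - 4 * (norm (x - (1/2) *\<^sub>R (u + v)))\<^sup>2"
proof -
  have 1: "u - v = (x - v) - (x - u)" by simp
  have "2 *\<^sub>R (x - (1/2) *\<^sub>R (u + v)) = (x - v) + (x - u)"
    by (simp add: scaleR_2 algebra_simps)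
  then have "2 * norm (x - (1/2) *\<^sub>R (u + v)) = norm ((x - v) + (x - u))"
    by (metis norm_scaleR abs_numeral)
  then have 2: "4 * (norm (x - (1/2) *\<^sub>R (u + v)))\<^sup>2 = (norm ((x - v) + (x - u)))\<^sup>2"
    by (metis power_mult_distrib four_x_squared)
  show ?thesis
    unfolding 2 unfolding 1 norm_add_sq norm_diff_sq[of "x - v" "x - u"] by simp
qed

text \<open>Closed complex-linear subspaces.\<close>

definition closed_csubspace :: "'a::complex_hilbert set \<Rightarrow> bool"
  where "closed_csubspace M \<longleftrightarrow> closed M \<and> 0 \<in> M \<and> (\<forall>x\<in>M. \<forall>y\<in>M. x + y \<in> M) \<and>
    (\<forall>c. \<forall>x\<in>M. c *\<^sub>C x \<in> M)"

lemma nearest_point_orthogonal: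
  fixes x v :: "'a::complex_hilbert"
  assumes M: "closed_csubspace M" and v: "v \<in> M"
    and min: "\<And>m. m \<in> M \<Longrightarrow> norm (x - v) \<le> norm (x - m)" and m: "m \<in> M"
  shows "cinner (x - v) m = 0"
proof -
  let ?z = "cinner (x - v) m" and ?s = "1 / (1 + (norm m)\<^sup>2)"
  have p: "1 + (norm m)\<^sup>2 > 0" by (simp add: add_pos_nonneg)
  let ?w = "(?s * ?z) *\<^sub>C m"
  \<comment> \<open>Moving \<open>v\<close> by \<open>s z m\<close> with \<open>s \<parallel>m\<parallel>\<^sup>2 < 1\<close> would shorten the distance if \<open>z\<close> were nonzero.\<close>
  have "v + ?w \<in> M" using M v m unfolding closed_csubspace_def by blast
  from min[OF this] have "(norm (x - v))\<^sup>2 \<le> (norm ((x - v) - ?w))\<^sup>2"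
    by (simp add: diff_diff_eq)
  moreover have "Re (cinner (x - v) ?w) = ?s * (cmod ?z)\<^sup>2"
  proof -
    have "cinner (x - v) ?w = complex_of_real ?s * (?z * cnj ?z)"
      unfolding cinner_scaleC_right
      by (simp only: complex_cnj_mult complex_cnj_complex_of_real mult.assoc
          mult.commute[of "cnj ?z"])
    also have "\<dots> = complex_of_real (?s * (cmod ?z)\<^sup>2)"
      by (simp only: complex_norm_square of_real_mult)
    finally show ?thesis by (simp only: Re_complex_of_real)
  qed
  moreover have "norm ?w = ?s * cmod ?z * norm m"
    using p unfolding norm_scaleC norm_mult norm_of_real by simp
  ultimately have "2 * (?s * (cmod ?z)\<^sup>2) \<le> (?s * cmod ?z * norm m)\<^sup>2"
    unfolding norm_diff_sq by simp
  also have "\<dots> = (?s * (cmod ?z)\<^sup>2) * (?s * (norm m)\<^sup>2)"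
    by (simp add: power2_eq_square)
  also have "\<dots> \<le> (?s * (cmod ?z)\<^sup>2) * 1"
    using p by (intro mult_left_mono) simp_all
  finally have "?s * (cmod ?z)\<^sup>2 \<le> 0" by simp
  moreover have "?s > 0" using p by simp
  ultimately have "(cmod ?z)\<^sup>2 \<le> 0"
    by (metis mult_pos_pos not_le)
  then show ?thesis by simp
qed

theorem projection_exists:
  fixes x :: "'a::complex_hilbert"
  assumes M: "closed_csubspace M"
  obtains v where "v \<in> M" "\<And>m. m \<in> M \<Longrightarrow> cinner (x - v) m = 0"
proof -
  have ne: "M \<noteq> {}" and cl: "closed M" using M unfolding closed_csubspace_def by auto
  define d where "d = infdist x M"
  have dle: "d \<le> norm (x - m)" if "m \<in> M" for m
    unfolding d_def dist_norm[symmetric] by (rule infdist_le[OF that])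
  have d0: "d \<ge> 0" unfolding d_def by (rule infdist_nonneg)
  have "\<exists>m\<in>M. norm (x - m) < d + inverse (Suc k)" for k :: nat
  proof (rule ccontr)
    assume "\<not> ?thesis"
    then have "d + inverse (Suc k) \<le> d"
      unfolding d_def infdist_notempty[OF ne] dist_norm
      by (intro cINF_greatest[OF ne]) (simp add: not_less)
    then show False by simp
  qed
  then obtain m where mM: "\<And>k. m k \<in> M" and m: "\<And>k. norm (x - m k) < d + inverse (Suc k)"
    by metis
  have mid: "(1/2) *\<^sub>R (m i + m j) \<in> M" for i j
    using M mM unfolding closed_csubspace_def scaleR_scaleC by blast
  have near: "(norm (x - m k))\<^sup>2 \<le> d\<^sup>2 + (2 * d + 1) * inverse (Suc k)" for k
  proof -
    have "(norm (x - m k))\<^sup>2 \<le> (d + inverse (Suc k))\<^sup>2"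
      using m[of k] by (intro power_mono) auto
    also have "\<dots> = d\<^sup>2 + 2 * d * inverse (Suc k) + inverse (Suc k) * inverse (Suc k)"
      by (simp add: power2_eq_square algebra_simps)
    also have "inverse (real (Suc k)) * inverse (Suc k) \<le> 1 * inverse (Suc k)"
      by (intro mult_right_mono) (auto simp: inverse_le_1_iff)
    finally show ?thesis by (simp add: algebra_simps)
  qed
  have est: "(norm (m i - m j))\<^sup>2 \<le> (4 * d + 2) * (inverse (Suc i) + inverse (Suc j))" for i j
  proof -
    have "d\<^sup>2 \<le> (norm (x - (1/2) *\<^sub>R (m i + m j)))\<^sup>2"
      using dle[OF mid] d0 by (intro power_mono)
    then show ?thesis
      unfolding parallelogram_midpoint[of "m i" "m j" x] using near[of i] near[of j]
      by (simp add: algebra_simps)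
  qed
  have "Cauchy m"
  proof (rule metric_CauchyI)
    fix e :: real assume e: "e > 0"
    have p: "4 * d + 2 > 0" using d0 by simp
    have half: "c * (e\<^sup>2 / (2 * c) + e\<^sup>2 / (2 * c)) = e\<^sup>2" if "c \<noteq> 0" for c :: real
      using that by (simp add: field_simps)
    obtain r where r: "r > 0" "(4 * d + 2) * (r + r) = e\<^sup>2"
    proof (rule that)
      show "e\<^sup>2 / (2 * (4 * d + 2)) > 0" using e p by simp
      show "(4 * d + 2) * (e\<^sup>2 / (2 * (4 * d + 2)) + e\<^sup>2 / (2 * (4 * d + 2))) = e\<^sup>2"
        by (rule half) (use p in linarith)
    qed
    obtain N where N: "inverse (real (Suc N)) < r"
      using reals_Archimedean[OF r(1)] by blast
    have "dist (m i) (m j) < e" if "i \<ge> N" "j \<ge> N" for i j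
    proof -
      have "inverse (real (Suc i)) \<le> inverse (Suc N)" "inverse (real (Suc j)) \<le> inverse (Suc N)"
        using that by (auto intro!: le_imp_inverse_le)
      then have "inverse (real (Suc i)) < r" "inverse (real (Suc j)) < r"
        using N by (meson le_less_trans)+
      then have "(4 * d + 2) * (inverse (real (Suc i)) + inverse (real (Suc j)))
          < (4 * d + 2) * (r + r)"
        by (intro mult_strict_left_mono add_strict_mono p)
      with est[of i j] have "(norm (m i - m j))\<^sup>2 < e\<^sup>2"
        unfolding r(2) by (rule le_less_trans)
      then show ?thesis
        using e unfolding dist_norm by (intro power2_less_imp_less[of _ e]) auto
    qed
    then show "\<exists>N. \<forall>i\<ge>N. \<forall>j\<ge>N. dist (m i) (m j) < e" by blast
  qed
  then obtain v where v: "m \<longlonglongrightarrow> v"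
    using Cauchy_convergent_iff convergent_def by blast
  have vM: "v \<in> M"
    using cl mM v closed_sequentially by blast
  have "(\<lambda>k. norm (x - m k)) \<longlonglongrightarrow> norm (x - v)"
    using v by (intro tendsto_intros)
  moreover have "(\<lambda>k. d + inverse (real (Suc k))) \<longlonglongrightarrow> d + 0"
    by (intro tendsto_intros LIMSEQ_inverse_real_of_nat)
  ultimately have "norm (x - v) \<le> d + 0"
    by (rule LIMSEQ_le) (use m less_imp_le in blast)
  then have "norm (x - v) \<le> norm (x - y)" if "y \<in> M" for y
    using dle[OF that] by simp
  from nearest_point_orthogonal[OF M vM this] vM show thesis
    by (intro that[of v])
qed

theorem Riesz_representation:
  fixes f :: "'a::complex_hilbert \<Rightarrow> complex"
  assumes bl: "bounded_linear f" and sc: "\<And>c x. f (c *\<^sub>C x) = c * f x"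
  shows "\<exists>y. \<forall>x. f x = cinner x y"
proof (cases "\<forall>x. f x = 0")
  case True
  then show ?thesis by (intro exI[of _ 0]) (simp add: cinner.zero_right)
next
  case False
  then obtain x0 where x0: "f x0 \<noteq> 0" by blast
  interpret f: bounded_linear f by (rule bl)
  have "closed (f -` {0})"
    by (rule continuous_closed_vimage) (auto intro: f.isCont)
  then have "closed_csubspace (f -` {0})"
    unfolding closed_csubspace_def by (auto simp: f.zero f.add sc)
  then obtain v where v: "f v = 0" "\<And>m. f m = 0 \<Longrightarrow> cinner (x0 - v) m = 0"
    using projection_exists[of "f -` {0}" x0] by auto
  let ?w = "x0 - v"
  have fw: "f ?w \<noteq> 0" using x0 v by (simp add: f.diff)
  then have "?w \<noteq> 0" using f.zero by metis
  then have ww: "cinner ?w ?w \<noteq> 0" by simp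
  \<comment> \<open>\<open>w\<close> is orthogonal to the kernel of \<open>f\<close>; the scalar is forced by evaluating at \<open>w\<close>.\<close>
  let ?c = "cnj (f ?w / cinner ?w ?w)"
  have "f x = cinner x (?c *\<^sub>C ?w)" for x
  proof -
    have "f (f ?w *\<^sub>C x - f x *\<^sub>C ?w) = 0" by (simp add: f.diff sc)
    from v(2)[OF this] have "cinner (f ?w *\<^sub>C x - f x *\<^sub>C ?w) ?w = 0"
      using cinner_eq_zero_commute by blast
    then have "f ?w * cinner x ?w = f x * cinner ?w ?w"
      by (simp add: cinner.diff_left cinner_scaleC_left)
    then show ?thesis
      using ww by (simp only: cinner_scaleC_right complex_cnj_cnj) (simp add: field_simps)
  qed
  then show ?thesis by blast
qed

section \<open>Adjoints and self-adjoint operators\<close>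

lemma adjoint_exists:
  fixes T :: "'a::complex_hilbert \<Rightarrow>\<^sub>L 'a"
  assumes T: "clinear_op T"
  shows "\<exists>S. clinear_op S \<and> (\<forall>x y. cinner (T x) y = cinner x (S y))"
proof -
  have "\<exists>z. \<forall>x. cinner (T x) y = cinner x z" for y
  proof (rule Riesz_representation)
    show "bounded_linear (\<lambda>x. cinner (T x) y)"
      by (rule bounded_linear_compose[OF cinner.bounded_linear_left blinfun.bounded_linear_right])
    show "cinner (T (c *\<^sub>C x)) y = c * cinner (T x) y" for c x
      using T unfolding clinear_op_def by (simp add: cinner_scaleC_left)
  qed
  then obtain S where S: "\<And>x y. cinner (T x) y = cinner x (S y)" by metis
  have S': "cinner (S y) x = cinner y (T x)" for x y
    by (metis S cinner_commute)
  have add: "S (x + y) = S x + S y" for x y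
    by (rule cinner_ext) (simp add: S' cinner_add_left)
  have scC: "S (c *\<^sub>C x) = c *\<^sub>C S x" for c x
    by (rule cinner_ext) (simp add: S' cinner_scaleC_left)
  have "norm (S y) \<le> norm y * norm T" for y
  proof (cases "S y = 0")
    case False
    have "complex_of_real ((norm (S y))\<^sup>2) = cinner (T (S y)) y"
      by (metis S cinner_self)
    then have "(norm (S y))\<^sup>2 = cmod (cinner (T (S y)) y)"
      by (metis norm_of_real abs_power2)
    also have "\<dots> \<le> norm (T (S y)) * norm y" by (rule Cauchy_Schwarz_cinner)
    also have "\<dots> \<le> (norm T * norm (S y)) * norm y"
      by (intro mult_right_mono norm_blinfun) simp
    finally have "norm (S y) * norm (S y) \<le> norm (S y) * (norm y * norm T)"
      by (simp add: power2_eq_square mult_ac)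
    then show ?thesis using False by simp
  qed simp
  then have bl: "bounded_linear S"
    by (intro bounded_linear_intro[where K = "norm T"]) (simp_all add: add scC scaleR_scaleC)
  have "blinfun_apply (Blinfun S) = S" by (rule bounded_linear_Blinfun_apply[OF bl])
  then show ?thesis
    by (intro exI[of _ "Blinfun S"]) (auto simp: clinear_op_def scC S)
qed

lemma op_adj:
  fixes T :: "'a::complex_hilbert \<Rightarrow>\<^sub>L 'a"
  assumes "clinear_op T"
  shows "clinear_op (op_adj T)" and "cinner (T x) y = cinner x (op_adj T y)"
proof -
  have "\<exists>!S. clinear_op S \<and> (\<forall>x y. cinner (T x) y = cinner x (S y))"
  proof (rule ex_ex1I[OF adjoint_exists[OF assms]])
    fix S S' :: "'a \<Rightarrow>\<^sub>L 'a"
    assume S: "clinear_op S \<and> (\<forall>x y. cinner (T x) y = cinner x (S y))"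
      and S': "clinear_op S' \<and> (\<forall>x y. cinner (T x) y = cinner x (S' y))"
    show "S = S'"
    proof (rule blinfun_eqI, rule cinner_ext)
      fix y z
      show "cinner (S y) z = cinner (S' y) z"
        using S S' by (metis cinner_commute)
    qed
  qed
  from theI'[OF this]
  show "clinear_op (op_adj T)" and "cinner (T x) y = cinner x (op_adj T y)"
    unfolding op_adj_def by blast+
qed

text \<open>Self-adjointness is stated through the inner product, without reference to \<open>op_adj\<close>.
  Complex linearity is then automatic, although the type only guarantees real linearity.\<close>

definition self_adjoint :: "('a::complex_hilbert \<Rightarrow>\<^sub>L 'a) \<Rightarrow> bool"
  where "self_adjoint A \<longleftrightarrow> (\<forall>x y. cinner (A x) y = cinner x (A y))"

lemma self_adjoint_imp_clinear:
  assumes "self_adjoint A" shows "clinear_op A"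
  unfolding clinear_op_def
proof (intro allI)
  fix c x
  show "A (c *\<^sub>C x) = c *\<^sub>C A x"
    by (rule cinner_ext) (use assms in \<open>simp add: self_adjoint_def cinner_scaleC_left\<close>)
qed

lemma self_adjointD: "self_adjoint A \<Longrightarrow> cinner (A x) y = cinner x (A y)"
  unfolding self_adjoint_def by blast

text \<open>A positive operator is self-adjoint with nonnegative quadratic form.\<close>

definition positive_op :: "('a::complex_hilbert \<Rightarrow>\<^sub>L 'a) \<Rightarrow> bool"
  where "positive_op A \<longleftrightarrow> self_adjoint A \<and> (\<forall>x. 0 \<le> Re (cinner (A x) x))"

lemma positive_adj_compose:
  assumes "clinear_op T" shows "positive_op (op_adj T o\<^sub>L T)"
proof -
  have *: "cinner (op_adj T (T x)) y = cinner (T x) (T y)" for x y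
    by (metis op_adj(2)[OF assms] cinner_commute)
  show ?thesis
    unfolding positive_op_def self_adjoint_def
    by (auto simp: * op_adj(2)[OF assms, symmetric] cinner_self simp del: of_real_power)
qed

lemma self_adjoint_id: "self_adjoint id_blinfun"
  by (simp add: self_adjoint_def)

lemma self_adjoint_add: "self_adjoint A \<Longrightarrow> self_adjoint B \<Longrightarrow> self_adjoint (A + B)"
  by (simp add: self_adjoint_def blinfun.add_left cinner_add_left cinner_add_right)

lemma self_adjoint_scaleR: "self_adjoint A \<Longrightarrow> self_adjoint (r *\<^sub>R A)"
  by (simp add: self_adjoint_def blinfun.scaleR_left cinner_scaleR_left cinner_scaleR_right)

lemma self_adjoint_diff: "self_adjoint A \<Longrightarrow> self_adjoint B \<Longrightarrow> self_adjoint (A - B)"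
  by (simp add: self_adjoint_def blinfun.diff_left cinner.diff_left cinner.diff_right)

lemma self_adjoint_compose:
  "self_adjoint A \<Longrightarrow> self_adjoint B \<Longrightarrow> A o\<^sub>L B = B o\<^sub>L A \<Longrightarrow> self_adjoint (A o\<^sub>L B)"
  unfolding self_adjoint_def by (metis blinfun_apply_blinfun_compose)

lemma self_adjoint_limit:
  assumes "\<And>k. self_adjoint (B k)" and "B \<longlonglongrightarrow> C"
  shows "self_adjoint C"
  unfolding self_adjoint_def
proof (intro allI)
  fix x y
  have *: "(\<lambda>k. B k z) \<longlonglongrightarrow> C z" for z
    using assms(2) by (intro blinfun.tendsto) auto
  have "(\<lambda>k. cinner (B k x) y) \<longlonglongrightarrow> cinner (C x) y" "(\<lambda>k. cinner x (B k y)) \<longlonglongrightarrow> cinner x (C y)"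
    by (intro cinner.tendsto * tendsto_const)+
  then show "cinner (C x) y = cinner x (C y)"
    using assms(1) LIMSEQ_unique unfolding self_adjoint_def by simp
qed

section \<open>Polynomials in an operator\<close>

lemma blinfun_compose_assoc: "(A o\<^sub>L B) o\<^sub>L C = A o\<^sub>L (B o\<^sub>L C)"
  by (rule blinfun_eqI) simp

lemma blinfun_compose_id [simp]: "A o\<^sub>L id_blinfun = A" "id_blinfun o\<^sub>L A = A"
  by (rule blinfun_eqI, simp)+

text \<open>The degree bound in the defining sum may be replaced by any larger one; this lets sums for
  different polynomials be compared.\<close>

lemma op_poly_eq_sum:
  assumes "degree p \<le> n"
  shows "op_poly p A = (\<Sum>i\<le>n. coeff p i *\<^sub>R op_power A i)"
  unfolding op_poly_def using assms
  by (intro sum.mono_neutral_left) (auto simp: coeff_eq_0)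

lemma op_poly_0 [simp]: "op_poly 0 A = 0"
  by (simp add: op_poly_def)

lemma op_poly_pCons: "op_poly (pCons a p) A = a *\<^sub>R id_blinfun + (A o\<^sub>L op_poly p A)"
proof -
  have "op_poly (pCons a p) A = a *\<^sub>R id_blinfun
      + (\<Sum>i\<le>degree p. coeff p i *\<^sub>R (A o\<^sub>L op_power A i))"
    using op_poly_eq_sum[of "pCons a p" "Suc (degree p)" A]
    unfolding sum.atMost_Suc_shift by (simp add: degree_pCons_le)
  also have "(\<Sum>i\<le>degree p. coeff p i *\<^sub>R (A o\<^sub>L op_power A i)) = A o\<^sub>L op_poly p A"
    unfolding op_poly_def
    by (rule blinfun_eqI) (simp add: blinfun.sum_left blinfun.sum_right blinfun.scaleR_left
        blinfun.scaleR_right)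
  finally show ?thesis .
qed

lemma op_poly_const: "op_poly [:a:] A = a *\<^sub>R id_blinfun"
  by (simp add: op_poly_pCons)

lemma op_poly_X: "op_poly [:0, 1:] A = A"
  by (simp add: op_poly_pCons)

lemma op_poly_add: "op_poly (p + q) A = op_poly p A + op_poly q A"
proof -
  let ?n = "max (degree p) (degree q)"
  have "degree (p + q) \<le> ?n" by (rule degree_add_le_max)
  then show ?thesis
    using op_poly_eq_sum[of p ?n A] op_poly_eq_sum[of q ?n A] op_poly_eq_sum[of "p + q" ?n A]
    by (simp add: scaleR_add_left sum.distrib)
qed

lemma op_poly_smult: "op_poly (smult c p) A = c *\<^sub>R op_poly p A"
  using op_poly_eq_sum[of "smult c p" "degree p" A] degree_smult_le[of c p]
  by (simp add: op_poly_def scaleR_right.sum)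

lemma op_poly_diff: "op_poly (p - q) A = op_poly p A - op_poly q A"
  using op_poly_add[of "p - q" q A] by simp

lemma op_poly_mult: "op_poly (p * q) A = op_poly p A o\<^sub>L op_poly q A"
proof (induction p)
  case 0
  then show ?case by simp
next
  case (pCons a p)
  have "op_poly (pCons a p * q) A = a *\<^sub>R op_poly q A + (A o\<^sub>L (op_poly p A o\<^sub>L op_poly q A))"
    by (simp add: op_poly_add op_poly_smult op_poly_pCons pCons.IH)
  also have "\<dots> = op_poly (pCons a p) A o\<^sub>L op_poly q A"
    by (rule blinfun_eqI) (simp add: op_poly_pCons blinfun.add_left blinfun.scaleR_left)
  finally show ?case .
qed

lemma op_poly_commute:
  assumes "S o\<^sub>L A = A o\<^sub>L S"
  shows "S o\<^sub>L op_poly p A = op_poly p A o\<^sub>L S"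
proof (induction p)
  case 0
  then show ?case by simp
next
  case (pCons a p)
  show ?case
  proof (rule blinfun_eqI)
    fix x
    have "S (A y) = A (S y)" "S (op_poly p A y) = op_poly p A (S y)" for y
      using assms pCons.IH by (metis blinfun_apply_blinfun_compose)+
    then show "(S o\<^sub>L op_poly (pCons a p) A) x = (op_poly (pCons a p) A o\<^sub>L S) x"
      by (simp add: op_poly_pCons blinfun.add_left blinfun.add_right blinfun.scaleR_left
          blinfun.scaleR_right)
  qed
qed

lemma self_adjoint_op_poly:
  assumes "self_adjoint A" shows "self_adjoint (op_poly p A)"
proof (induction p)
  case 0
  show ?case by (simp add: self_adjoint_def cinner.zero_left cinner.zero_right)
next
  case (pCons a p)
  then show ?case
    unfolding op_poly_pCons
    by (intro self_adjoint_add self_adjoint_scaleR self_adjoint_id self_adjoint_compose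
        assms op_poly_commute refl)
qed

lemma op_poly_kernel:
  fixes A :: "'a::real_normed_vector \<Rightarrow>\<^sub>L 'a"
  assumes "A x = 0" shows "op_poly p A x = poly p 0 *\<^sub>R x"
proof (induction p)
  case (pCons a p)
  then show ?case
    by (simp add: op_poly_pCons blinfun.add_left blinfun.scaleR_left blinfun.scaleR_right assms)
qed simp

section \<open>Operators bounded below and the spectrum of a self-adjoint operator\<close>

text \<open>An operator \<open>F\<close> is bounded below if \<open>k \<parallel>x\<parallel> \<le> \<parallel>F x\<parallel>\<close> for some \<open>k > 0\<close>. The negation for
  \<open>A - t\<close> says that \<open>t\<close> is an approximate eigenvalue of \<open>A\<close>.\<close>

definition bounded_below :: "('a::real_normed_vector \<Rightarrow>\<^sub>L 'b::real_normed_vector) \<Rightarrow> bool"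
  where "bounded_below F \<longleftrightarrow> (\<exists>k>0. \<forall>x. k * norm x \<le> norm (F x))"

lemma bounded_below_compose:
  assumes "bounded_below F" "bounded_below G" shows "bounded_below (F o\<^sub>L G)"
proof -
  obtain k l where k: "k > 0" "\<And>x. k * norm x \<le> norm (F x)"
    and l: "l > 0" "\<And>x. l * norm x \<le> norm (G x)"
    using assms unfolding bounded_below_def by metis
  have "(k * l) * norm x \<le> norm (F (G x))" for x
  proof -
    have "k * (l * norm x) \<le> k * norm (G x)" using k(1) l(2) by (intro mult_left_mono) auto
    also have "\<dots> \<le> norm (F (G x))" by (rule k(2))
    finally show ?thesis by (simp add: mult.assoc)
  qed
  then show ?thesis
    unfolding bounded_below_def using k(1) l(1) by (intro exI[of _ "k * l"]) simp
qed

lemma bounded_below_by_form: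
  fixes F :: "'a::complex_hilbert \<Rightarrow>\<^sub>L 'a"
  assumes "k > 0" and "\<And>x. k * (norm x)\<^sup>2 \<le> Re (cinner (F x) x)"
  shows "bounded_below F"
  unfolding bounded_below_def
proof (intro exI[of _ k] conjI allI assms(1))
  fix x
  have "k * (norm x)\<^sup>2 \<le> cmod (cinner (F x) x)"
    using assms(2)[of x] complex_Re_le_cmod order_trans by blast
  also have "\<dots> \<le> norm (F x) * norm x" by (rule Cauchy_Schwarz_cinner)
  finally have "(k * norm x) * norm x \<le> norm (F x) * norm x"
    by (simp add: power2_eq_square mult.assoc)
  then show "k * norm x \<le> norm (F x)"
    by (cases "x = 0") auto
qed

lemma quadratic_dvd_if_nonreal_root:
  fixes q :: "real poly" and z :: complex
  assumes root: "poly (map_poly complex_of_real q) z = 0" and im: "Im z \<noteq> 0"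
  shows "[:(Re z)\<^sup>2 + (Im z)\<^sup>2, - 2 * Re z, 1:] dvd q"
proof -
  \<comment> \<open>The remainder modulo the quadratic has degree at most \<open>1\<close>, is real, and vanishes at \<open>z\<close>.\<close>
  let ?d = "[:(Re z)\<^sup>2 + (Im z)\<^sup>2, - 2 * Re z, 1:]"
  let ?e = "\<lambda>p. poly (map_poly complex_of_real p) z"
  have pc: "?e (pCons a p) = of_real a + z * ?e p" for a p
    by (simp add: map_poly_pCons)
  have add: "?e (p + r) = ?e p + ?e r" for p r
    unfolding poly_add[symmetric]
    by (rule arg_cong[where f = "\<lambda>u. poly u z"], rule poly_eqI) (simp add: coeff_map_poly)
  have sm: "?e (smult c p) = of_real c * ?e p" for c p
    by (induction p) (simp_all add: pc algebra_simps)
  have mul: "?e (p * r) = ?e p * ?e r" for p r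
    by (induction p) (simp_all add: pc add sm algebra_simps)
  have d0: "?e ?d = 0"
    by (simp add: pc complex_eq_iff power2_eq_square algebra_simps)
  define r where "r = q mod ?d"
  have "q = ?d * (q div ?d) + r" unfolding r_def by (rule mult_div_mod_eq[symmetric])
  then have "?e r = 0" using root d0 by (metis add mul mult_zero_left add_0)
  have "r = 0 \<or> degree r < degree ?d"
    unfolding r_def by (rule degree_mod_less) simp
  then have "degree r \<le> 1" by auto
  then have "r = [:coeff r 0, coeff r 1:]"
    by (intro poly_eqI) (auto simp: coeff_pCons coeff_eq_0 split: nat.split)
  then obtain a b where ab: "r = [:a, b:]" by blast
  then have "b * Im z = 0" "a + b * Re z = 0"
    using \<open>?e r = 0\<close> by (auto simp: pc complex_eq_iff algebra_simps)
  then have "r = 0" using im ab by simp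
  then show ?thesis unfolding r_def by (simp add: dvd_eq_mod_eq_0)
qed

lemma real_poly_factor:
  fixes q :: "real poly"
  assumes "degree q > 0"
  obtains (linear) t s where "q = [:- t, 1:] * s"
  | (quadratic) a b s where "b \<noteq> 0" "q = [:a\<^sup>2 + b\<^sup>2, - 2 * a, 1:] * s"
proof -
  have "degree (map_poly complex_of_real q) = degree q"
    by (rule degree_map_poly) simp
  then obtain z where z: "poly (map_poly complex_of_real q) z = 0"
    using fundamental_theorem_of_algebra_alt[of "map_poly complex_of_real q"] assms by fastforce
  show thesis
  proof (cases "Im z = 0")
    case True
    then have "z = complex_of_real (Re z)" by (simp add: complex_eq_iff)
    moreover have "poly (map_poly complex_of_real q) (complex_of_real x)
        = complex_of_real (poly q x)" for x
      by (induction q) (simp_all add: map_poly_pCons)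
    ultimately have "complex_of_real (poly q (Re z)) = 0"
      using z by metis
    then have "poly q (Re z) = 0" by simp
    then show thesis using linear unfolding poly_eq_0_iff_dvd by (metis dvdE)
  next
    case False
    then show thesis using quadratic quadratic_dvd_if_nonreal_root[OF z] by (metis dvdE)
  qed
qed

text \<open>The quadratic is \<open>(x - a)\<^sup>2 + b\<^sup>2\<close>, so its value at \<open>A\<close> has quadratic form at least
  \<open>b\<^sup>2 \<parallel>x\<parallel>\<^sup>2\<close>.\<close>

lemma bounded_below_quadratic:
  assumes A: "self_adjoint A" and b: "b \<noteq> 0"
  shows "bounded_below (op_poly [:a\<^sup>2 + b\<^sup>2, - 2 * a, 1:] A)"
proof (rule bounded_below_by_form[of "b\<^sup>2"])
  let ?B = "A - a *\<^sub>R id_blinfun"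
  have B: "self_adjoint ?B"
    by (intro self_adjoint_diff self_adjoint_scaleR self_adjoint_id A)
  fix x
  have "[:a\<^sup>2 + b\<^sup>2, - 2 * a, 1:] = [:- a, 1:] * [:- a, 1:] + [:b\<^sup>2:]"
    by (simp add: power2_eq_square)
  then have "op_poly [:a\<^sup>2 + b\<^sup>2, - 2 * a, 1:] A x = ?B (?B x) + b\<^sup>2 *\<^sub>R x"
    by (simp add: op_poly_add op_poly_mult op_poly_pCons blinfun.bilinear_simps algebra_simps)
      (simp flip: scaleR_add_left)
  then have "cinner (op_poly [:a\<^sup>2 + b\<^sup>2, - 2 * a, 1:] A x) x
      = cinner (?B x) (?B x) + b\<^sup>2 *\<^sub>R cinner x x"
    using self_adjointD[OF B] by (simp add: cinner_add_left cinner_scaleR_left)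
  then show "b\<^sup>2 * (norm x)\<^sup>2 \<le> Re (cinner (op_poly [:a\<^sup>2 + b\<^sup>2, - 2 * a, 1:] A x) x)"
    by (simp add: cinner_self scaleR_conv_of_real del: of_real_power)
qed (use b in simp)

text \<open>Factor \<open>q\<close>: irreducible quadratic factors are always bounded below at \<open>A\<close>, linear ones by
  hypothesis, and products inherit the property.\<close>

lemma bounded_below_op_poly:
  assumes A: "self_adjoint A" and "q \<noteq> 0"
    and "\<And>t. poly q t = 0 \<Longrightarrow> bounded_below (A - t *\<^sub>R id_blinfun)"
  shows "bounded_below (op_poly q A)"
  using assms(2,3)
proof (induction "degree q" arbitrary: q rule: less_induct)
  case (less q)
  show ?case
  proof (cases "degree q = 0")
    case True
    then obtain c where c: "q = [:c:]" by (metis degree_eq_zeroE)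
    then show ?thesis
      using less.prems(1) unfolding bounded_below_def
      by (intro exI[of _ "\<bar>c\<bar>"]) (simp add: op_poly_const blinfun.scaleR_left)
  next
    case False
    have rec: "bounded_below (op_poly q A)" if "q = d * s" "degree d > 0"
      "bounded_below (op_poly d A)" for d s
    proof -
      have "s \<noteq> 0" "d \<noteq> 0" using that(1) less.prems(1) by auto
      then have "degree s < degree q" using that by (simp add: degree_mult_eq)
      then have "bounded_below (op_poly s A)"
        using less.hyps[of s] less.prems(2) \<open>s \<noteq> 0\<close> that(1) by simp
      then show ?thesis
        unfolding that(1) op_poly_mult using that(3) by (intro bounded_below_compose)
    qed
    from False have "degree q > 0" by simp
    then show ?thesis
    proof (cases rule: real_poly_factor)
      case (linear t s)
      then have "bounded_below (A - t *\<^sub>R id_blinfun)" using less.prems(2)[of t] by simp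
      moreover have "op_poly [:- t, 1:] A = A - t *\<^sub>R id_blinfun"
        by (simp add: op_poly_pCons)
      ultimately show ?thesis using rec[OF linear] by simp
    next
      case (quadratic b a s)
      show ?thesis
        by (rule rec[OF quadratic(2)]) (use bounded_below_quadratic[OF A quadratic(1)] in simp_all)
    qed
  qed
qed

text \<open>The norm of a self-adjoint operator is attained, up to sign, on its approximate point
  spectrum: otherwise \<open>(B - \<parallel>B\<parallel>)(B + \<parallel>B\<parallel>) = B\<^sup>2 - \<parallel>B\<parallel>\<^sup>2\<close> would be bounded below, which for
  nonzero \<open>B\<close> makes \<open>\<parallel>B x\<parallel>\<^sup>2 \<le> b \<parallel>x\<parallel>\<^sup>2\<close> with a constant \<open>b < \<parallel>B\<parallel>\<^sup>2\<close>.\<close>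

lemma self_adjoint_norm_not_bounded_below:
  fixes B :: "'a::complex_hilbert \<Rightarrow>\<^sub>L 'a"
  assumes B: "self_adjoint B" and x0: "(x0::'a) \<noteq> 0"
  obtains s where "\<bar>s\<bar> = norm B" "\<not> bounded_below (B - s *\<^sub>R id_blinfun)"
proof (rule ccontr)
  assume no: "\<not> thesis"
  let ?c = "norm B"
  have "bounded_below ((B - ?c *\<^sub>R id_blinfun) o\<^sub>L (B - (- ?c) *\<^sub>R id_blinfun))"
    using that[of ?c] that[of "- ?c"] no by (intro bounded_below_compose) auto
  moreover have "((B - ?c *\<^sub>R id_blinfun) o\<^sub>L (B - (- ?c) *\<^sub>R id_blinfun)) x
      = B (B x) - ?c\<^sup>2 *\<^sub>R x" for x
    by (simp add: blinfun.bilinear_simps power2_eq_square scaleR_diff_right)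
  ultimately obtain k where k: "k > 0" "\<And>x. k * norm x \<le> norm (B (B x) - ?c\<^sup>2 *\<^sub>R x)"
    unfolding bounded_below_def by auto
  have est: "?c\<^sup>2 * (norm (B x))\<^sup>2 + k\<^sup>2 * (norm x)\<^sup>2 \<le> ?c\<^sup>2 * (?c\<^sup>2 * (norm x)\<^sup>2)" for x
  proof -
    have inner: "cinner (B (B x)) (?c\<^sup>2 *\<^sub>R x) = ?c\<^sup>2 *\<^sub>R cinner (B x) (B x)"
      by (simp only: cinner_scaleR_right self_adjointD[OF B, of "B x"])
    have "(k * norm x)\<^sup>2 \<le> (norm (B (B x) - ?c\<^sup>2 *\<^sub>R x))\<^sup>2"
      using k by (intro power_mono) auto
    also have "\<dots> = (norm (B (B x)))\<^sup>2 + (?c\<^sup>2 * norm x)\<^sup>2 - 2 * (?c\<^sup>2 * (norm (B x))\<^sup>2)"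
      unfolding norm_diff_sq by (simp add: inner cinner_self del: of_real_power)
    finally have main: "k\<^sup>2 * (norm x)\<^sup>2
        \<le> (norm (B (B x)))\<^sup>2 + ?c\<^sup>2 * (?c\<^sup>2 * (norm x)\<^sup>2) - 2 * (?c\<^sup>2 * (norm (B x))\<^sup>2)"
      by (simp only: power_mult_distrib power2_eq_square[of "?c\<^sup>2"] mult.assoc)
    have "(norm (B (B x)))\<^sup>2 \<le> (?c * norm (B x))\<^sup>2"
      by (intro power_mono norm_blinfun) simp
    then show ?thesis using main unfolding power_mult_distrib by linarith
  qed
  show False
  proof (cases "?c = 0")
    case True
    then have "k\<^sup>2 * (norm x0)\<^sup>2 \<le> 0" using est[of x0] by simp
    then show False using k(1) x0 by (simp add: mult_le_0_iff)
  next
    case False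
    then have c: "?c > 0" by simp
    let ?b = "?c\<^sup>2 - k\<^sup>2 / ?c\<^sup>2"
    have le: "(norm (B x))\<^sup>2 \<le> ?b * (norm x)\<^sup>2" for x
      using est[of x] c by (simp add: field_simps power2_eq_square)
    have "0 \<le> ?b * (norm x0)\<^sup>2" using le[of x0] zero_le_power2 order_trans by blast
    then have b0: "0 \<le> ?b" using x0 by (simp add: zero_le_mult_iff)
    have "norm (B x) \<le> sqrt ?b * norm x" for x
      using real_sqrt_le_mono[OF le[of x]] by (simp add: real_sqrt_mult)
    then have "?c \<le> sqrt ?b"
      using b0 by (intro norm_blinfun_bound) auto
    then have "?c\<^sup>2 \<le> ?b" using b0 c by (metis norm_ge_zero power_mono real_sqrt_pow2)
    then show False using k(1) c by (simp add: divide_le_0_iff)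
  qed
qed

text \<open>The real part of the spectrum, as a set of real numbers. It is the set on which \<open>fun_calc\<close>
  asks for uniform convergence.\<close>

definition real_spectrum :: "('a::complex_hilbert \<Rightarrow>\<^sub>L 'a) \<Rightarrow> real set"
  where "real_spectrum A = {t. complex_of_real t \<in> op_spectrum A}"

lemma in_real_spectrum_if_not_bounded_below:
  fixes A :: "'a::complex_hilbert \<Rightarrow>\<^sub>L 'a"
  assumes "\<not> bounded_below (A - t *\<^sub>R id_blinfun)"
  shows "t \<in> real_spectrum A"
proof (rule ccontr)
  assume "t \<notin> real_spectrum A"
  then obtain B :: "'a \<Rightarrow>\<^sub>L 'a" where B: "\<And>x. B (A x - t *\<^sub>R x) = x"
    unfolding real_spectrum_def op_spectrum_def by (auto simp: scaleR_scaleC)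
  have pos: "norm B + 1 > 0" by (simp add: add_nonneg_pos)
  have "1 / (norm B + 1) * norm x \<le> norm ((A - t *\<^sub>R id_blinfun) x)" for x
  proof -
    let ?y = "(A - t *\<^sub>R id_blinfun) x"
    have "norm x = norm (B ?y)" by (simp add: B blinfun.diff_left blinfun.scaleR_left)
    also have "\<dots> \<le> norm B * norm ?y" by (rule norm_blinfun)
    also have "\<dots> \<le> (norm B + 1) * norm ?y" by (intro mult_right_mono) auto
    finally have "norm x / (norm B + 1) \<le> norm ?y"
      using pos_divide_le_eq[OF pos] by (simp only: mult.commute)
    then show ?thesis by simp
  qed
  moreover have "1 / (norm B + 1) > 0" using pos by simp
  ultimately show False using assms unfolding bounded_below_def by blast
qed

text \<open>For self-adjoint operators the converse holds: if \<open>A - t\<close> is bounded below, its range is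
  closed, and the orthogonal complement of the range is the kernel of \<open>A - t\<close>, hence trivial.\<close>

lemma bounded_below_not_in_real_spectrum:
  fixes A :: "'a::complex_hilbert \<Rightarrow>\<^sub>L 'a"
  assumes A: "self_adjoint A" and bb: "bounded_below (A - t *\<^sub>R id_blinfun)"
  shows "t \<notin> real_spectrum A"
proof -
  let ?F = "A - t *\<^sub>R id_blinfun"
  have F: "self_adjoint ?F"
    by (intro self_adjoint_diff self_adjoint_scaleR self_adjoint_id A)
  have Fc: "?F (c *\<^sub>C x) = c *\<^sub>C ?F x" for c x
    using self_adjoint_imp_clinear[OF F] unfolding clinear_op_def by blast
  obtain k where k: "k > 0" "\<And>x. k * norm x \<le> norm (?F x)"
    using bb unfolding bounded_below_def by blast
  have "closed (range ?F)"
  proof -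
    have "complete (?F ` UNIV)"
      by (rule complete_isometric_image[OF k(1) subspace_UNIV blinfun.bounded_linear_right])
        (use k complete_UNIV in \<open>auto simp: mult.commute\<close>)
    then show ?thesis by (rule complete_imp_closed)
  qed
  then have M: "closed_csubspace (range ?F)"
    unfolding closed_csubspace_def
    by (auto simp flip: blinfun.add_right Fc intro: range_eqI[of _ _ 0])
  have inj: "inj ?F"
  proof (rule injI)
    fix x y assume "?F x = ?F y"
    then have "?F (x - y) = 0" by (simp add: blinfun.diff_right)
    then have "k * norm (x - y) \<le> 0" using k(2)[of "x - y"] by simp
    then show "x = y" using k(1) by (simp add: mult_le_0_iff)
  qed
  have "y \<in> range ?F" for y
  proof -
    obtain v where v: "v \<in> range ?F" "\<And>m. m \<in> range ?F \<Longrightarrow> cinner (y - v) m = 0"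
      using projection_exists[OF M] by blast
    have "cinner (?F (y - v)) z = cinner 0 z" for z
      using v(2)[of "?F z"] by (simp only: self_adjointD[OF F] cinner.zero_left rangeI)
    then have "?F (y - v) = 0" by (rule cinner_ext)
    then have "?F (y - v) = ?F 0" by simp
    then have "y - v = 0" using inj by (rule injD[rotated])
    then show ?thesis using v(1) by simp
  qed
  then have surj: "surj ?F" by auto
  let ?G = "inv ?F"
  have GF: "?G (?F x) = x" and FG: "?F (?G x) = x" for x
    using inj surj by (simp_all add: surj_f_inv_f)
  have Gc: "?G (c *\<^sub>C x) = c *\<^sub>C ?G x" for c x
    by (metis GF FG Fc)
  have bl: "bounded_linear ?G"
  proof (rule bounded_linear_intro[where K = "1 / k"])
    show "?G (x + y) = ?G x + ?G y" for x y
      by (metis GF FG blinfun.add_right)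
    show "?G (r *\<^sub>R x) = r *\<^sub>R ?G x" for r x
      by (metis GF FG blinfun.scaleR_right)
    show "norm (?G x) \<le> norm x * (1 / k)" for x
      using k(2)[of "?G x"] k(1) unfolding FG by (simp add: field_simps)
  qed
  have Gb: "blinfun_apply (Blinfun ?G) = ?G" by (rule bounded_linear_Blinfun_apply[OF bl])
  have Feq: "?F x = A x - complex_of_real t *\<^sub>C x" for x
    by (simp add: blinfun.bilinear_simps scaleR_scaleC)
  have "clinear_op (Blinfun ?G)" unfolding clinear_op_def Gb by (simp only: Gc simp_thms)
  moreover have "Blinfun ?G (A x - complex_of_real t *\<^sub>C x) = x" for x
    unfolding Gb Feq[symmetric] by (rule GF)
  moreover have "A (Blinfun ?G x) - complex_of_real t *\<^sub>C Blinfun ?G x = x" for x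
    unfolding Gb Feq[symmetric] by (rule FG)
  ultimately show ?thesis
    unfolding real_spectrum_def op_spectrum_def by blast
qed

lemma real_spectrum_positive:
  fixes A :: "'a::complex_hilbert \<Rightarrow>\<^sub>L 'a"
  assumes "positive_op A" shows "real_spectrum A \<subseteq> {0..norm A}"
proof
  fix t assume t: "t \<in> real_spectrum A"
  have A: "self_adjoint A" and pos: "\<And>x. 0 \<le> Re (cinner (A x) x)"
    using assms unfolding positive_op_def by auto
  have nb: "\<not> bounded_below (A - t *\<^sub>R id_blinfun)"
    using bounded_below_not_in_real_spectrum[OF A] t by blast
  have "t \<ge> 0"
  proof (rule ccontr)
    assume "\<not> t \<ge> 0"
    then have "bounded_below (A - t *\<^sub>R id_blinfun)"
      by (intro bounded_below_by_form[of "- t"])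
        (use pos in \<open>auto simp: blinfun.bilinear_simps cinner.diff_left cinner_scaleR_left
          cinner_self simp del: of_real_power\<close>)
    with nb show False by blast
  qed
  moreover have "t \<le> norm A"
  proof (rule ccontr)
    assume t: "\<not> t \<le> norm A"
    have "(t - norm A) * norm x \<le> norm ((A - t *\<^sub>R id_blinfun) x)" for x
    proof -
      have "t * norm x = norm (t *\<^sub>R x)" using \<open>t \<ge> 0\<close> by simp
      also have "\<dots> \<le> norm (A x) + norm (A x - t *\<^sub>R x)"
        using norm_triangle_ineq4[of "A x" "A x - t *\<^sub>R x"] by simp
      also have "norm (A x) \<le> norm A * norm x" by (rule norm_blinfun)
      finally show ?thesis by (simp add: blinfun.bilinear_simps algebra_simps)
    qed
    then have "bounded_below (A - t *\<^sub>R id_blinfun)"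
      unfolding bounded_below_def using t by (intro exI[of _ "t - norm A"]) simp
    with nb show False by blast
  qed
  ultimately show "t \<in> {0..norm A}" by simp
qed

text \<open>The hypothesis \<open>M \<ge> 0\<close> covers the zero space, where the spectrum is empty.\<close>

theorem norm_op_poly_le:
  fixes A :: "'a::complex_hilbert \<Rightarrow>\<^sub>L 'a"
  assumes A: "self_adjoint A" and M: "M \<ge> 0"
    and bound: "\<And>t. t \<in> real_spectrum A \<Longrightarrow> \<bar>poly p t\<bar> \<le> M"
  shows "norm (op_poly p A) \<le> M"
proof (cases "\<exists>x::'a. x \<noteq> 0")
  case False
  then have "op_poly p A = 0" by (intro blinfun_eqI) (metis)
  then show ?thesis using M by simp
next
  case True
  then obtain x0 :: 'a where x0: "x0 \<noteq> 0" by blast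
  obtain s0 where s0: "s0 \<in> real_spectrum A"
    using self_adjoint_norm_not_bounded_below[OF A x0] in_real_spectrum_if_not_bounded_below
    by metis
  obtain s where s: "\<bar>s\<bar> = norm (op_poly p A)"
    and nb: "\<not> bounded_below (op_poly p A - s *\<^sub>R id_blinfun)"
    using self_adjoint_norm_not_bounded_below[OF self_adjoint_op_poly[OF A] x0] by blast
  \<comment> \<open>If \<open>p\<close> is the constant \<open>s\<close>, any point \<open>s0\<close> of the spectrum serves.\<close>
  have "\<exists>t\<in>real_spectrum A. poly p t = s"
  proof (cases "p = [:s:]")
    case True
    then show ?thesis using s0 by auto
  next
    case False
    then have "p - [:s:] \<noteq> 0" by simp
    moreover have "\<not> bounded_below (op_poly (p - [:s:]) A)"
      using nb by (simp add: op_poly_diff op_poly_const)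
    ultimately obtain t where "poly (p - [:s:]) t = 0" "\<not> bounded_below (A - t *\<^sub>R id_blinfun)"
      using bounded_below_op_poly[OF A] by blast
    then show ?thesis using in_real_spectrum_if_not_bounded_below by force
  qed
  then show ?thesis using bound s by metis
qed

section \<open>Continuous functional calculus of a positive operator\<close>

text \<open>\<open>has_fun_calc A f B\<close> is the relation \<open>B = f(A)\<close> whose unique solution \<open>fun_calc f A\<close>
  selects: \<open>B\<close> is the norm limit of \<open>p\<^sub>k(A)\<close> for some polynomials \<open>p\<^sub>k\<close> tending to \<open>f\<close> uniformly
  on the real spectrum. Working with the relation avoids proving existence at every step.\<close>

definition has_fun_calc :: "('a::complex_hilbert \<Rightarrow>\<^sub>L 'a) \<Rightarrow> (real \<Rightarrow> real) \<Rightarrow> ('a \<Rightarrow>\<^sub>L 'a) \<Rightarrow> bool"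
  where "has_fun_calc A f B \<longleftrightarrow> (\<exists>p :: nat \<Rightarrow> real poly.
    uniform_limit (real_spectrum A) (\<lambda>k. poly (p k)) f sequentially \<and>
    (\<lambda>k. op_poly (p k) A) \<longlonglongrightarrow> B)"

text \<open>The norm bound for polynomials passes to the limit. It gives uniqueness of \<open>f(A)\<close>
  (\<open>M = 0\<close>) and continuity in \<open>f\<close>.\<close>

lemma has_fun_calc_dist_le:
  fixes A B C :: "'a::complex_hilbert \<Rightarrow>\<^sub>L 'a"
  assumes A: "self_adjoint A" and f: "has_fun_calc A f B" and g: "has_fun_calc A g C"
    and M: "M \<ge> 0" and le: "\<And>t. t \<in> real_spectrum A \<Longrightarrow> \<bar>f t - g t\<bar> \<le> M"
  shows "norm (B - C) \<le> M"
proof (rule field_le_epsilon)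
  fix e :: real assume e: "e > 0"
  obtain p where p: "uniform_limit (real_spectrum A) (\<lambda>k. poly (p k)) f sequentially"
    and pB: "(\<lambda>k. op_poly (p k) A) \<longlonglongrightarrow> B" using f unfolding has_fun_calc_def by blast
  obtain q where q: "uniform_limit (real_spectrum A) (\<lambda>k. poly (q k)) g sequentially"
    and qC: "(\<lambda>k. op_poly (q k) A) \<longlonglongrightarrow> C" using g unfolding has_fun_calc_def by blast
  have "\<forall>\<^sub>F k in sequentially. norm (op_poly (p k) A - op_poly (q k) A) \<le> M + e"
    using uniform_limitD[OF p half_gt_zero[OF e]] uniform_limitD[OF q half_gt_zero[OF e]]
  proof eventually_elim
    case (elim k)
    have "\<bar>poly (p k - q k) t\<bar> \<le> M + e" if t: "t \<in> real_spectrum A" for t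
    proof -
      have "\<bar>poly (p k) t - f t\<bar> < e / 2" "\<bar>poly (q k) t - g t\<bar> < e / 2" "\<bar>f t - g t\<bar> \<le> M"
        using elim t le by (auto simp: dist_real_def)
      then show ?thesis unfolding poly_diff by linarith
    qed
    then show ?case
      unfolding op_poly_diff[symmetric] using M e by (intro norm_op_poly_le[OF A]) auto
  qed
  moreover have "(\<lambda>k. norm (op_poly (p k) A - op_poly (q k) A)) \<longlonglongrightarrow> norm (B - C)"
    by (intro tendsto_norm tendsto_diff pB qC)
  ultimately show "norm (B - C) \<le> M + e"
    by (intro tendsto_upperbound) auto
qed

lemma has_fun_calc_unique:
  assumes "self_adjoint A" "has_fun_calc A f B" "has_fun_calc A g C"
    and "\<And>t. t \<in> real_spectrum A \<Longrightarrow> f t = g t"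
  shows "B = C"
  using has_fun_calc_dist_le[OF assms(1-3), of 0] assms(4) by simp

lemma fun_calc_eqI:
  assumes "self_adjoint A" "has_fun_calc A f B" shows "fun_calc f A = B"
  unfolding fun_calc_def
proof (fold real_spectrum_def, fold has_fun_calc_def, rule the_equality)
  show "has_fun_calc A f B" by (rule assms(2))
  show "C = B" if "has_fun_calc A f C" for C
    by (rule has_fun_calc_unique[OF assms(1) that assms(2)]) (rule refl)
qed

lemma has_fun_calc_poly: "has_fun_calc A (poly p) (op_poly p A)"
  unfolding has_fun_calc_def
  by (intro exI[of _ "\<lambda>_. p"]) (auto intro: uniform_limitI)

lemma has_fun_calc_const: "has_fun_calc A (\<lambda>_. c) (c *\<^sub>R id_blinfun)"
proof -
  have "poly [:c:] = (\<lambda>_. c)" by (rule ext) simp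
  then show ?thesis using has_fun_calc_poly[of A "[:c:]"] by (simp add: op_poly_const)
qed

lemma has_fun_calc_id: "has_fun_calc A (\<lambda>t. t) A"
proof -
  have "poly [:0, 1:] = (\<lambda>t :: real. t)" by (rule ext) simp
  then show ?thesis using has_fun_calc_poly[of A "[:0, 1:]"] by (simp add: op_poly_X)
qed

lemma has_fun_calc_add:
  assumes "has_fun_calc A f B" "has_fun_calc A g C"
  shows "has_fun_calc A (\<lambda>t. f t + g t) (B + C)"
proof -
  obtain p where p: "uniform_limit (real_spectrum A) (\<lambda>k. poly (p k)) f sequentially"
    and pB: "(\<lambda>k. op_poly (p k) A) \<longlonglongrightarrow> B" using assms(1) unfolding has_fun_calc_def by blast
  obtain q where q: "uniform_limit (real_spectrum A) (\<lambda>k. poly (q k)) g sequentially"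
    and qC: "(\<lambda>k. op_poly (q k) A) \<longlonglongrightarrow> C" using assms(2) unfolding has_fun_calc_def by blast
  show ?thesis
    unfolding has_fun_calc_def
  proof (intro exI[of _ "\<lambda>k. p k + q k"] conjI)
    show "uniform_limit (real_spectrum A) (\<lambda>k. poly (p k + q k)) (\<lambda>t. f t + g t) sequentially"
      unfolding poly_add[abs_def] by (rule uniform_limit_add[OF p q])
    show "(\<lambda>k. op_poly (p k + q k) A) \<longlonglongrightarrow> B + C"
      unfolding op_poly_add by (rule tendsto_add[OF pB qC])
  qed
qed

text \<open>Boundedness of both limit functions is what makes products of uniformly convergent
  sequences converge uniformly.\<close>

lemma has_fun_calc_bounded:
  fixes A :: "'a::complex_hilbert \<Rightarrow>\<^sub>L 'a"
  assumes A: "positive_op A" and f: "has_fun_calc A f B"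
  shows "bounded (f ` real_spectrum A)"
proof -
  obtain p where p: "uniform_limit (real_spectrum A) (\<lambda>k. poly (p k)) f sequentially"
    using f unfolding has_fun_calc_def by blast
  obtain k where k: "\<And>t. t \<in> real_spectrum A \<Longrightarrow> dist (poly (p k) t) (f t) < 1"
    using eventually_happens[OF uniform_limitD[OF p zero_less_one]] by auto
  have "compact (poly (p k) ` {0..norm A})"
    by (intro compact_continuous_image continuous_intros compact_Icc)
  then obtain M where M: "\<And>t. t \<in> {0..norm A} \<Longrightarrow> norm (poly (p k) t) \<le> M"
    using compact_imp_bounded bounded_iff by (metis imageI)
  have "norm (f t) \<le> M + 1" if "t \<in> real_spectrum A" for t
    using k[OF that] M[of t] that real_spectrum_positive[OF A]
    unfolding dist_real_def real_norm_def by fastforce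
  then show ?thesis unfolding bounded_iff by blast
qed

lemma has_fun_calc_mult:
  fixes A :: "'a::complex_hilbert \<Rightarrow>\<^sub>L 'a"
  assumes A: "positive_op A" and f: "has_fun_calc A f B" and g: "has_fun_calc A g C"
  shows "has_fun_calc A (\<lambda>t. f t * g t) (B o\<^sub>L C)"
proof -
  obtain p where p: "uniform_limit (real_spectrum A) (\<lambda>k. poly (p k)) f sequentially"
    and pB: "(\<lambda>k. op_poly (p k) A) \<longlonglongrightarrow> B" using f unfolding has_fun_calc_def by blast
  obtain q where q: "uniform_limit (real_spectrum A) (\<lambda>k. poly (q k)) g sequentially"
    and qC: "(\<lambda>k. op_poly (q k) A) \<longlonglongrightarrow> C" using g unfolding has_fun_calc_def by blast
  show ?thesis
    unfolding has_fun_calc_def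
  proof (intro exI[of _ "\<lambda>k. p k * q k"] conjI)
    show "uniform_limit (real_spectrum A) (\<lambda>k. poly (p k * q k)) (\<lambda>t. f t * g t) sequentially"
      unfolding poly_mult[abs_def]
      by (intro uniform_lim_mult p q has_fun_calc_bounded[OF A f] has_fun_calc_bounded[OF A g])
    show "(\<lambda>k. op_poly (p k * q k) A) \<longlonglongrightarrow> (B o\<^sub>L C)"
      unfolding op_poly_mult
      by (rule bounded_bilinear.tendsto[OF bounded_bilinear_blinfun_compose pB qC])
  qed
qed

lemma has_fun_calc_poly_compose:
  assumes A: "positive_op A" and f: "has_fun_calc A f B"
  shows "has_fun_calc A (\<lambda>t. poly p (f t)) (op_poly p B)"
proof (induction p)
  case 0
  show ?case using has_fun_calc_const[of A 0] by simp
next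
  case (pCons a p)
  show ?case
    unfolding op_poly_pCons poly_pCons
    by (intro has_fun_calc_add has_fun_calc_const has_fun_calc_mult[OF A f pCons.IH])
qed

lemma blinfun_compose_limit_commute:
  assumes "B \<longlonglongrightarrow> C" and "\<And>k. S o\<^sub>L B k = B k o\<^sub>L S"
  shows "S o\<^sub>L C = C o\<^sub>L S"
proof -
  have "(\<lambda>k. S o\<^sub>L B k) \<longlonglongrightarrow> (S o\<^sub>L C)" "(\<lambda>k. B k o\<^sub>L S) \<longlonglongrightarrow> (C o\<^sub>L S)"
    by (intro bounded_bilinear.tendsto[OF bounded_bilinear_blinfun_compose] tendsto_const assms(1))+
  then show ?thesis unfolding assms(2) by (rule LIMSEQ_unique)
qed

lemma has_fun_calc_commute:
  assumes "has_fun_calc A f B" and "S o\<^sub>L A = A o\<^sub>L S"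
  shows "S o\<^sub>L B = B o\<^sub>L S"
proof -
  obtain p where "(\<lambda>k. op_poly (p k) A) \<longlonglongrightarrow> B" using assms(1) unfolding has_fun_calc_def by blast
  then show ?thesis
    by (rule blinfun_compose_limit_commute) (rule op_poly_commute[OF assms(2)])
qed

lemma has_fun_calc_self_adjoint:
  assumes "has_fun_calc A f B" and "self_adjoint A"
  shows "self_adjoint B"
proof -
  obtain p where "(\<lambda>k. op_poly (p k) A) \<longlonglongrightarrow> B" using assms(1) unfolding has_fun_calc_def by blast
  then show ?thesis
    by (rule self_adjoint_limit[rotated]) (rule self_adjoint_op_poly[OF assms(2)])
qed

text \<open>A nonzero vector in the kernel of \<open>A\<close> puts \<open>0\<close> into the spectrum, and \<open>f(A)\<close> acts on it as
  the scalar \<open>f 0\<close>.\<close>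

lemma has_fun_calc_kernel:
  fixes A :: "'a::complex_hilbert \<Rightarrow>\<^sub>L 'a"
  assumes f: "has_fun_calc A f B" and Ax: "A x = 0"
  shows "B x = f 0 *\<^sub>R x"
proof (cases "x = 0")
  case False
  have "\<not> bounded_below A"
  proof
    assume "bounded_below A"
    then obtain k where "k > 0" "k * norm x \<le> norm (A x)"
      unfolding bounded_below_def by blast
    then show False using False Ax by (simp add: mult_le_0_iff)
  qed
  then have 0: "0 \<in> real_spectrum A"
    by (intro in_real_spectrum_if_not_bounded_below) simp
  obtain p where p: "uniform_limit (real_spectrum A) (\<lambda>k. poly (p k)) f sequentially"
    and pB: "(\<lambda>k. op_poly (p k) A) \<longlonglongrightarrow> B" using f unfolding has_fun_calc_def by blast
  have "(\<lambda>k. op_poly (p k) A x) \<longlonglongrightarrow> B x"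
    using pB by (intro blinfun.tendsto) auto
  moreover have "(\<lambda>k. op_poly (p k) A x) \<longlonglongrightarrow> f 0 *\<^sub>R x"
    unfolding op_poly_kernel[OF Ax]
    by (intro tendsto_scaleR tendsto_uniform_limitI[OF p 0] tendsto_const)
  ultimately show ?thesis by (rule LIMSEQ_unique)
qed simp

lemma Weierstrass_poly_sequence:
  fixes f :: "real \<Rightarrow> real"
  assumes "continuous_on {a..b} f"
  obtains p :: "nat \<Rightarrow> real poly"
  where "\<And>k t. t \<in> {a..b} \<Longrightarrow> \<bar>poly (p k) t - f t\<bar> < inverse (real (Suc k))"
proof -
  have "\<exists>p :: real poly. \<forall>t\<in>{a..b}. \<bar>poly p t - f t\<bar> < inverse (real (Suc k))" for k
  proof -
    have "inverse (real (Suc k)) > 0" by simp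
    then obtain g where g: "real_polynomial_function g"
      "\<And>t. t \<in> {a..b} \<Longrightarrow> \<bar>f t - g t\<bar> < inverse (real (Suc k))"
      using Stone_Weierstrass_real_polynomial_function[OF compact_Icc assms] by blast
    then obtain c n where c: "g = (\<lambda>x. \<Sum>i\<le>n. c i * x ^ i)"
      unfolding real_polynomial_function_iff_sum by blast
    have "poly (\<Sum>i\<le>n. monom (c i) i) t = g t" for t
      by (simp add: c poly_sum poly_monom)
    then show ?thesis using g(2) by (metis abs_minus_commute)
  qed
  then show thesis using that by metis
qed

lemma has_fun_calc_exists:
  fixes A :: "'a::complex_hilbert \<Rightarrow>\<^sub>L 'a"
  assumes A: "positive_op A" and f: "continuous_on {0..norm A} f"
  shows "\<exists>B. has_fun_calc A f B"
proof -
  have sa: "self_adjoint A" using A unfolding positive_op_def by blast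
  obtain p where p: "\<And>k t. t \<in> {0..norm A} \<Longrightarrow> \<bar>poly (p k) t - f t\<bar> < inverse (real (Suc k))"
    using Weierstrass_poly_sequence[OF f] by blast
  have inv: "\<exists>N. \<forall>n\<ge>N. inverse (real (Suc n)) < e" if e: "e > 0" for e :: real
  proof -
    obtain N where N: "inverse (real (Suc N)) < e" using reals_Archimedean[OF e] by blast
    have "inverse (real (Suc n)) < e" if "n \<ge> N" for n
      by (rule le_less_trans[OF le_imp_inverse_le N]) (use that in auto)
    then show ?thesis by blast
  qed
  have "uniform_limit (real_spectrum A) (\<lambda>k. poly (p k)) f sequentially"
    unfolding uniform_limit_sequentially_iff dist_real_def
    using inv p real_spectrum_positive[OF A] by (meson less_trans subsetD)
  moreover have "Cauchy (\<lambda>k. op_poly (p k) A)"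
  proof (rule metric_CauchyI)
    fix e :: real assume "e > 0"
    then obtain N where N: "\<And>n. n \<ge> N \<Longrightarrow> inverse (real (Suc n)) < e / 2"
      using inv[of "e / 2"] by auto
    have "dist (op_poly (p m) A) (op_poly (p n) A) < e" if "m \<ge> N" "n \<ge> N" for m n
    proof -
      let ?M = "inverse (real (Suc m)) + inverse (real (Suc n))"
      have "norm (op_poly (p m - p n) A) \<le> ?M"
      proof (rule norm_op_poly_le[OF sa])
        fix t assume "t \<in> real_spectrum A"
        then have "t \<in> {0..norm A}" using real_spectrum_positive[OF A] by blast
        from p[OF this, of m] p[OF this, of n]
        show "\<bar>poly (p m - p n) t\<bar> \<le> ?M" unfolding poly_diff by linarith
      qed simp
      also have "\<dots> < e" using N[OF that(1)] N[OF that(2)] by linarith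
      finally show ?thesis by (simp add: op_poly_diff dist_norm)
    qed
    then show "\<exists>N. \<forall>m\<ge>N. \<forall>n\<ge>N. dist (op_poly (p m) A) (op_poly (p n) A) < e" by blast
  qed
  then obtain B where "(\<lambda>k. op_poly (p k) A) \<longlonglongrightarrow> B"
    using Cauchy_convergent_iff convergent_def by blast
  ultimately show ?thesis unfolding has_fun_calc_def by blast
qed

section \<open>Powers of a positive operator\<close>

text \<open>The conditional reflects the convention that the zeroth power is the identity, although
  \<open>0 powr 0 = 0\<close>.\<close>

lemma has_fun_calc_op_powr:
  assumes A: "positive_op A" and r: "0 \<le> r"
  shows "has_fun_calc A (\<lambda>t. if r = 0 then 1 else t powr r) (op_powr A r)"
proof -
  have sa: "self_adjoint A" using A unfolding positive_op_def by blast
  have "continuous_on {0..norm A} (\<lambda>t. if r = 0 then 1 else t powr r)"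
    using r by (cases "r = 0")
      (auto intro!: continuous_on_powr' continuous_on_id continuous_on_const)
  then obtain B where B: "has_fun_calc A (\<lambda>t. if r = 0 then 1 else t powr r) B"
    using has_fun_calc_exists[OF A] by blast
  show ?thesis
    unfolding op_powr_def fun_calc_eqI[OF sa B] by (rule B)
qed

lemma op_powr_add:
  assumes A: "positive_op A" and r: "0 \<le> r" and s: "0 \<le> s"
  shows "op_powr A r o\<^sub>L op_powr A s = op_powr A (r + s)"
proof (rule has_fun_calc_unique)
  show "self_adjoint A" using A unfolding positive_op_def by blast
  show "has_fun_calc A (\<lambda>t. (if r = 0 then 1 else t powr r) * (if s = 0 then 1 else t powr s))
      (op_powr A r o\<^sub>L op_powr A s)"
    by (intro has_fun_calc_mult has_fun_calc_op_powr assms)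
  show "has_fun_calc A (\<lambda>t. if r + s = 0 then 1 else t powr (r + s)) (op_powr A (r + s))"
    using r s by (intro has_fun_calc_op_powr A) simp
qed (use r s in \<open>auto simp: powr_add\<close>)

lemma op_powr_one:
  assumes A: "positive_op A" shows "op_powr A 1 = A"
proof (rule has_fun_calc_unique)
  show "self_adjoint A" using A unfolding positive_op_def by blast
  show "has_fun_calc A (\<lambda>t. if (1::real) = 0 then 1 else t powr 1) (op_powr A 1)"
    by (rule has_fun_calc_op_powr[OF A]) simp
  show "has_fun_calc A (\<lambda>t. t) A" by (rule has_fun_calc_id)
qed (use real_spectrum_positive[OF A] in auto)

lemma op_powr_zero:
  assumes A: "positive_op A" shows "op_powr A 0 = id_blinfun"
proof (rule has_fun_calc_unique)
  show "self_adjoint A" using A unfolding positive_op_def by blast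
  show "has_fun_calc A (\<lambda>t. if (0::real) = 0 then 1 else t powr 0) (op_powr A 0)"
    by (rule has_fun_calc_op_powr[OF A]) simp
  show "has_fun_calc A (\<lambda>t. 1) id_blinfun" using has_fun_calc_const[of A 1] by simp
qed simp

lemma op_powr_commute:
  assumes "positive_op A" "0 \<le> r" "S o\<^sub>L A = A o\<^sub>L S"
  shows "S o\<^sub>L op_powr A r = op_powr A r o\<^sub>L S"
  by (rule has_fun_calc_commute[OF has_fun_calc_op_powr[OF assms(1,2)] assms(3)])

lemma op_powr_kernel:
  assumes "positive_op A" "0 < r" "A x = 0" shows "op_powr A r x = 0"
  using has_fun_calc_kernel[OF has_fun_calc_op_powr[OF assms(1), of r] assms(3)] assms(2) by simp

lemma positive_op_powr:
  assumes A: "positive_op A" and r: "0 \<le> r" shows "positive_op (op_powr A r)"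
proof -
  have sa: "self_adjoint (op_powr A s)" if "0 \<le> s" for s
    using A has_fun_calc_self_adjoint[OF has_fun_calc_op_powr[OF A that]]
    unfolding positive_op_def by blast
  have "op_powr A r = op_powr A (r / 2) o\<^sub>L op_powr A (r / 2)"
    using op_powr_add[OF A, of "r / 2" "r / 2"] r by simp
  then have "cinner (op_powr A r x) x = cinner (op_powr A (r / 2) x) (op_powr A (r / 2) x)" for x
    using self_adjointD[OF sa[of "r / 2"]] r by simp
  then show ?thesis
    using sa[OF r] unfolding positive_op_def by (simp add: cinner_self del: of_real_power)
qed

text \<open>Since \<open>t = (t powr l) powr (1 / l)\<close>, the operator \<open>A\<close> is a norm limit of polynomials in
  its \<open>l\<close>-th power.\<close>

lemma commute_if_commute_op_powr:
  fixes A :: "'a::complex_hilbert \<Rightarrow>\<^sub>L 'a"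
  assumes A: "positive_op A" and l: "0 < l"
    and comm: "S o\<^sub>L op_powr A l = op_powr A l o\<^sub>L S"
  shows "S o\<^sub>L A = A o\<^sub>L S"
proof -
  have sa: "self_adjoint A" using A unfolding positive_op_def by blast
  have "continuous_on {0..norm A powr l} (\<lambda>s. s powr (1 / l))"
    using l by (intro continuous_on_powr' continuous_on_id continuous_on_const) auto
  then obtain p where p: "\<And>k s. s \<in> {0..norm A powr l} \<Longrightarrow>
      \<bar>poly (p k) s - s powr (1 / l)\<bar> < inverse (real (Suc k))"
    using Weierstrass_poly_sequence by blast
  have fc: "has_fun_calc A (\<lambda>t. t powr l) (op_powr A l)"
    using has_fun_calc_op_powr[OF A, of l] l by simp
  have "norm (op_poly (p k) (op_powr A l) - A) \<le> inverse (real (Suc k))" for k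
  proof (rule has_fun_calc_dist_le[OF sa has_fun_calc_poly_compose[OF A fc] has_fun_calc_id])
    fix t assume "t \<in> real_spectrum A"
    then have t: "0 \<le> t" "t \<le> norm A" using real_spectrum_positive[OF A] by auto
    then have "t powr l \<in> {0..norm A powr l}" using l by (auto intro: powr_mono2)
    moreover have "(t powr l) powr (1 / l) = t" using t l by (simp add: powr_powr)
    ultimately show "\<bar>poly (p k) (t powr l) - t\<bar> \<le> inverse (real (Suc k))"
      using p[of "t powr l" k] by simp
  qed simp
  then have "(\<lambda>k. op_poly (p k) (op_powr A l) - A) \<longlonglongrightarrow> 0"
    by (intro Lim_null_comparison[OF _ LIMSEQ_inverse_real_of_nat] always_eventually allI)
  then have "(\<lambda>k. op_poly (p k) (op_powr A l)) \<longlonglongrightarrow> A"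
    by (simp only: LIM_zero_iff)
  then show ?thesis
    by (rule blinfun_compose_limit_commute) (rule op_poly_commute[OF comm])
qed

section \<open>The polar decomposition\<close>

lemma scaleC_0_right [simp]: "c *\<^sub>C 0 = (0::'a::complex_vector)"
  using scaleC_add_right[of c 0 0] by simp

lemma tendsto_scaleC:
  fixes x :: "'a::complex_hilbert"
  assumes "f \<longlonglongrightarrow> x" shows "(\<lambda>k. c *\<^sub>C f k) \<longlonglongrightarrow> c *\<^sub>C x"
proof -
  have "bounded_linear (\<lambda>x::'a. c *\<^sub>C x)"
    by (rule bounded_linear_intro[where K = "cmod c"])
      (simp_all add: scaleC_add_right scaleR_scaleC scaleC_scaleC norm_scaleC mult.commute)
  then show ?thesis using assms by (rule bounded_linear.tendsto)
qed

text \<open>Every \<open>x\<close> is the sum of an element \<open>w\<close> of the kernel and a limit of elements \<open>A y\<^sub>k\<close> of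
  the range: project onto the closure of the range, whose orthogonal complement is the kernel.\<close>

lemma kernel_range_decomposition:
  fixes A :: "'a::complex_hilbert \<Rightarrow>\<^sub>L 'a"
  assumes A: "self_adjoint A"
  obtains y w where "A w = 0" "(\<lambda>k. A (y k)) \<longlonglongrightarrow> x - w"
proof -
  have Ac: "A (c *\<^sub>C z) = c *\<^sub>C A z" for c z
    using self_adjoint_imp_clinear[OF A] unfolding clinear_op_def by blast
  have "closed_csubspace (closure (range A))"
    unfolding closed_csubspace_def
  proof (intro conjI ballI allI)
    show "0 \<in> closure (range A)"
      by (rule subsetD[OF closure_subset]) (rule range_eqI[of _ _ 0], simp)
    fix u c assume "u \<in> closure (range A)"
    then obtain f where f: "\<And>k. f k \<in> range A" "f \<longlonglongrightarrow> u"
      unfolding closure_sequential by blast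
    have "c *\<^sub>C f k \<in> range A" for k
      using f(1)[of k] by (auto simp flip: Ac)
    then show "c *\<^sub>C u \<in> closure (range A)"
      unfolding closure_sequential
      by (intro exI[of _ "\<lambda>k. c *\<^sub>C f k"] conjI allI tendsto_scaleC f(2))
    fix v assume "v \<in> closure (range A)"
    then obtain g where g: "\<And>k. g k \<in> range A" "g \<longlonglongrightarrow> v"
      unfolding closure_sequential by blast
    have "f k + g k \<in> range A" for k
      using f(1)[of k] g(1)[of k] by (auto simp flip: blinfun.add_right)
    then show "u + v \<in> closure (range A)"
      unfolding closure_sequential
      by (intro exI[of _ "\<lambda>k. f k + g k"] conjI allI tendsto_add f(2) g(2))
  qed simp
  then obtain v where v: "v \<in> closure (range A)"
    "\<And>m. m \<in> closure (range A) \<Longrightarrow> cinner (x - v) m = 0"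
    using projection_exists by blast
  have "cinner (A (x - v)) z = cinner 0 z" for z
    unfolding self_adjointD[OF A] cinner.zero_left
    by (rule v(2)) (rule subsetD[OF closure_subset rangeI])
  then have "A (x - v) = 0" by (rule cinner_ext)
  moreover obtain f where f: "\<And>k. f k \<in> range A" "f \<longlonglongrightarrow> v"
    using v(1) unfolding closure_sequential by blast
  have "\<forall>k. \<exists>z. f k = A z" using f(1) by blast
  then obtain y where "\<And>k. f k = A (y k)" using choice[of "\<lambda>k z. f k = A z"] by blast
  then have "f = (\<lambda>k. A (y k))" by (rule ext)
  with f(2) have "(\<lambda>k. A (y k)) \<longlonglongrightarrow> x - (x - v)" by simp
  ultimately show thesis by (rule that)
qed

lemma eq_on_range_and_kernel_imp_eq:
  fixes A F G :: "'a::complex_hilbert \<Rightarrow>\<^sub>L 'a"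
  assumes A: "self_adjoint A" and range: "F o\<^sub>L A = G o\<^sub>L A"
    and ker: "\<And>w. A w = 0 \<Longrightarrow> F w = G w"
  shows "F = G"
proof (rule blinfun_eqI)
  fix x
  obtain y w where w: "A w = 0" and y: "(\<lambda>k. A (y k)) \<longlonglongrightarrow> x - w"
    by (rule kernel_range_decomposition[OF A])
  have eq: "F (A z) = G (A z)" for z using range by (metis blinfun_apply_blinfun_compose)
  have "(\<lambda>k. F (A (y k))) \<longlonglongrightarrow> F (x - w)" "(\<lambda>k. G (A (y k))) \<longlonglongrightarrow> G (x - w)"
    by (intro blinfun.tendsto tendsto_const y)+
  then have "F (x - w) = G (x - w)" unfolding eq by (rule LIMSEQ_unique)
  then show "F x = G x" using ker[OF w] by (simp add: blinfun.diff_right)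
qed

text \<open>The partial isometry sends \<open>lim A y\<^sub>k\<close> to \<open>lim T y\<^sub>k\<close> and vanishes on the kernel of \<open>A\<close>.
  In the proof, \<open>R x u w\<close> says that \<open>u\<close> is a value of this map at \<open>x\<close>, where \<open>w\<close> is the
  component of \<open>x\<close> in the kernel. The relation is total, closed under linear combinations and
  contractive, so it is the graph of a bounded linear map.\<close>

lemma polar_decomposition_exists:
  fixes A T :: "'a::complex_hilbert \<Rightarrow>\<^sub>L 'a"
  assumes A: "self_adjoint A" and T: "clinear_op T" and norm_eq: "\<And>x. norm (A x) = norm (T x)"
  shows "\<exists>U. partial_isometry U \<and> T = U o\<^sub>L A \<and> op_ker U = op_ker A"
proof -
  define R where "R x u w \<longleftrightarrow>
    A w = 0 \<and> (\<exists>y. (\<lambda>k. A (y k)) \<longlonglongrightarrow> x - w \<and> (\<lambda>k. T (y k)) \<longlonglongrightarrow> u)" for x u w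
  have Ac: "A (c *\<^sub>C z) = c *\<^sub>C A z" and Tc: "T (c *\<^sub>C z) = c *\<^sub>C T z" for c z
    using self_adjoint_imp_clinear[OF A] T unfolding clinear_op_def by blast+
  have total: "\<exists>u w. R x u w" for x
  proof -
    obtain y w where w: "A w = 0" and y: "(\<lambda>k. A (y k)) \<longlonglongrightarrow> x - w"
      by (rule kernel_range_decomposition[OF A])
    have "dist (T (y m)) (T (y n)) = dist (A (y m)) (A (y n))" for m n
      by (simp add: dist_norm norm_eq flip: blinfun.diff_right)
    then have "Cauchy (\<lambda>k. T (y k))"
      using LIMSEQ_imp_Cauchy[OF y] unfolding Cauchy_def by simp
    then obtain u where "(\<lambda>k. T (y k)) \<longlonglongrightarrow> u"
      using Cauchy_convergent_iff convergent_def by blast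
    then show ?thesis unfolding R_def using w y by blast
  qed
  have orth: "cinner (x - w) w = 0" and isom: "norm u = norm (x - w)" if "R x u w" for x u w
  proof -
    obtain y where w: "A w = 0" and y: "(\<lambda>k. A (y k)) \<longlonglongrightarrow> x - w" "(\<lambda>k. T (y k)) \<longlonglongrightarrow> u"
      using \<open>R x u w\<close> unfolding R_def by blast
    have "(\<lambda>k. cinner (A (y k)) w) \<longlonglongrightarrow> cinner (x - w) w"
      by (intro cinner.tendsto y tendsto_const)
    then have "(\<lambda>k. 0) \<longlonglongrightarrow> cinner (x - w) w"
      by (simp only: self_adjointD[OF A] w cinner.zero_right)
    then show "cinner (x - w) w = 0" using LIMSEQ_unique tendsto_const by blast
    have "(\<lambda>k. norm (A (y k))) \<longlonglongrightarrow> norm (x - w)" "(\<lambda>k. norm (T (y k))) \<longlonglongrightarrow> norm u"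
      by (intro tendsto_norm y)+
    then show "norm u = norm (x - w)" unfolding norm_eq using LIMSEQ_unique by blast
  qed
  have le: "norm u \<le> norm x" if "R x u w" for x u w
  proof -
    have "(norm x)\<^sup>2 = (norm (x - w))\<^sup>2 + (norm w)\<^sup>2"
      using norm_add_sq[of "x - w" w] orth[OF that] by simp
    then have "(norm u)\<^sup>2 \<le> (norm x)\<^sup>2" unfolding isom[OF that] by simp
    then show ?thesis by (rule power2_le_imp_le) simp
  qed
  have add: "R (x + x') (u + u') (w + w')" if R: "R x u w" "R x' u' w'" for x x' u u' w w'
  proof -
    obtain y where y: "A w = 0" "(\<lambda>k. A (y k)) \<longlonglongrightarrow> x - w" "(\<lambda>k. T (y k)) \<longlonglongrightarrow> u"
      using R(1) unfolding R_def by blast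
    obtain y' where y': "A w' = 0" "(\<lambda>k. A (y' k)) \<longlonglongrightarrow> x' - w'" "(\<lambda>k. T (y' k)) \<longlonglongrightarrow> u'"
      using R(2) unfolding R_def by blast
    have "(\<lambda>k. A (y k + y' k)) \<longlonglongrightarrow> (x + x') - (w + w')"
      using tendsto_add[OF y(2) y'(2)] by (simp add: blinfun.add_right add_diff_add)
    moreover have "(\<lambda>k. T (y k + y' k)) \<longlonglongrightarrow> u + u'"
      using tendsto_add[OF y(3) y'(3)] by (simp add: blinfun.add_right)
    ultimately show ?thesis
      unfolding R_def using y(1) y'(1)
      by (intro conjI exI[of _ "\<lambda>k. y k + y' k"]) (simp_all add: blinfun.add_right)
  qed
  have scale: "R (c *\<^sub>C x) (c *\<^sub>C u) (c *\<^sub>C w)" if R: "R x u w" for c x u w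
  proof -
    obtain y where y: "A w = 0" "(\<lambda>k. A (y k)) \<longlonglongrightarrow> x - w" "(\<lambda>k. T (y k)) \<longlonglongrightarrow> u"
      using R unfolding R_def by blast
    have "c *\<^sub>C (x - w) = c *\<^sub>C x - c *\<^sub>C w"
      by (metis add_diff_cancel diff_add_cancel scaleC_add_right)
    then show ?thesis
      unfolding R_def using tendsto_scaleC[OF y(2), of c] tendsto_scaleC[OF y(3), of c]
      by (intro conjI exI[of _ "\<lambda>k. c *\<^sub>C y k"]) (simp_all add: Ac Tc y(1))
  qed
  have unique: "u = u'" if "R x u w" "R x u' w'" for x u u' w w'
  proof -
    have "R (x + (-1) *\<^sub>C x) (u + (-1) *\<^sub>C u') (w + (-1) *\<^sub>C w')"
      by (intro add scale that)
    from le[OF this] show ?thesis by (simp add: scaleC_minus_one)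
  qed
  obtain U W where UW: "\<And>x. R x (U x) (W x)" using total by metis
  have U_eq: "U x = u" if "R x u w" for x u w using unique[OF UW that] .
  have Uc: "U (c *\<^sub>C x) = c *\<^sub>C U x" for c x by (rule U_eq[OF scale[OF UW]])
  have "bounded_linear U"
  proof (rule bounded_linear_intro[where K = 1])
    show "U (x + y) = U x + U y" for x y by (rule U_eq[OF add[OF UW UW]])
    show "U (r *\<^sub>R x) = r *\<^sub>R U x" for r x unfolding scaleR_scaleC by (rule Uc)
    show "norm (U x) \<le> norm x * 1" for x using le[OF UW] by simp
  qed
  then have Ub: "blinfun_apply (Blinfun U) = U" by (rule bounded_linear_Blinfun_apply)
  have ker: "U x = 0 \<longleftrightarrow> A x = 0" for x
  proof
    assume "U x = 0"
    then have "x = W x" using isom[OF UW[of x]] by simp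
    then show "A x = 0" using UW[of x] unfolding R_def by simp
  next
    assume "A x = 0"
    then have "R x 0 x" unfolding R_def by (intro conjI exI[of _ "\<lambda>_. 0"]) simp_all
    then show "U x = 0" by (rule U_eq)
  qed
  have "norm (U x) = norm x" if orth_ker: "\<And>y. U y = 0 \<Longrightarrow> cinner x y = 0" for x
  proof -
    have "A (W x) = 0" using UW[of x] unfolding R_def by blast
    then have "cinner x (W x) = 0" using orth_ker ker by blast
    then have "cinner (W x) (W x) = 0"
      using orth[OF UW[of x]] by (simp add: cinner.diff_left)
    then have "W x = 0" by simp
    then show ?thesis using isom[OF UW[of x]] by simp
  qed
  then have "partial_isometry (Blinfun U)"
    unfolding partial_isometry_def clinear_op_def op_ker_def Ub using Uc by blast
  moreover have "T = Blinfun U o\<^sub>L A"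
  proof (rule blinfun_eqI)
    fix x
    have "R (A x) (T x) 0" unfolding R_def by (intro conjI exI[of _ "\<lambda>_. x"]) simp_all
    then show "T x = (Blinfun U o\<^sub>L A) x" by (simp add: Ub U_eq)
  qed
  moreover have "op_ker (Blinfun U) = op_ker A" unfolding op_ker_def Ub ker by (rule refl)
  ultimately show ?thesis by blast
qed

lemma positive_op_abs: "clinear_op T \<Longrightarrow> positive_op (op_abs T)"
  unfolding op_abs_def by (intro positive_op_powr positive_adj_compose) simp_all

lemma op_abs_square:
  assumes "clinear_op T" shows "op_abs T o\<^sub>L op_abs T = op_adj T o\<^sub>L T"
  using op_powr_add[OF positive_adj_compose[OF assms], of "1/2" "1/2"]
    op_powr_one[OF positive_adj_compose[OF assms]]
  unfolding op_abs_def by simp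

lemma norm_op_abs:
  assumes T: "clinear_op T" shows "norm (op_abs T x) = norm (T x)"
proof -
  have sa: "self_adjoint (op_abs T)" using positive_op_abs[OF T] unfolding positive_op_def by blast
  have "cinner (op_abs T x) (op_abs T x) = cinner x ((op_abs T o\<^sub>L op_abs T) x)"
    by (simp add: self_adjointD[OF sa])
  also have "\<dots> = cinner (T x) (T x)"
    by (simp add: op_abs_square[OF T] op_adj(2)[OF T])
  finally have "(norm (op_abs T x))\<^sup>2 = (norm (T x))\<^sup>2"
    unfolding cinner_self using of_real_eq_iff by blast
  then show ?thesis by (simp add: power2_eq_iff_nonneg)
qed

theorem polar_isometry:
  fixes T :: "'a::complex_hilbert \<Rightarrow>\<^sub>L 'a"
  assumes T: "clinear_op T"
  shows "polar_isometry T o\<^sub>L op_abs T = T"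
    and "op_ker (polar_isometry T) = op_ker (op_abs T)"
proof -
  have sa: "self_adjoint (op_abs T)" using positive_op_abs[OF T] unfolding positive_op_def by blast
  have "\<exists>!U. partial_isometry U \<and> T = U o\<^sub>L op_abs T \<and> op_ker U = op_ker (op_abs T)"
  proof (rule ex_ex1I[OF polar_decomposition_exists[OF sa T norm_op_abs[OF T]]])
    fix U V
    assume U: "partial_isometry U \<and> T = U o\<^sub>L op_abs T \<and> op_ker U = op_ker (op_abs T)"
      and V: "partial_isometry V \<and> T = V o\<^sub>L op_abs T \<and> op_ker V = op_ker (op_abs T)"
    show "U = V"
    proof (rule eq_on_range_and_kernel_imp_eq[OF sa])
      show "U o\<^sub>L op_abs T = V o\<^sub>L op_abs T" using U V by metis
      fix w assume "op_abs T w = 0"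
      then have "w \<in> op_ker (op_abs T)" unfolding op_ker_def by simp
      then have "w \<in> op_ker U" "w \<in> op_ker V" using U V by blast+
      then show "U w = V w" unfolding op_ker_def by simp
    qed
  qed
  from theI'[OF this] have "partial_isometry (polar_isometry T) \<and>
      T = polar_isometry T o\<^sub>L op_abs T \<and> op_ker (polar_isometry T) = op_ker (op_abs T)"
    unfolding polar_isometry_def .
  then show "polar_isometry T o\<^sub>L op_abs T = T"
    and "op_ker (polar_isometry T) = op_ker (op_abs T)"
    by (blast intro: sym)+
qed

section \<open>Powers of the Aluthge transform\<close>

lemma op_power_intertwine:
  assumes "D o\<^sub>L B = B o\<^sub>L T"
  shows "op_power D n o\<^sub>L B = B o\<^sub>L op_power T n"
proof (induction n)
  case (Suc n)
  have "op_power D (Suc n) o\<^sub>L B = D o\<^sub>L (op_power D n o\<^sub>L B)"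
    by (simp add: blinfun_compose_assoc)
  also have "\<dots> = (D o\<^sub>L B) o\<^sub>L op_power T n" by (simp add: Suc.IH blinfun_compose_assoc)
  also have "\<dots> = B o\<^sub>L op_power T (Suc n)" by (simp add: assms blinfun_compose_assoc)
  finally show ?case .
qed simp

lemma op_power_kernel:
  fixes F :: "'a::real_normed_vector \<Rightarrow>\<^sub>L 'a"
  assumes "F x = 0" "1 \<le> n" shows "op_power F n x = 0"
  using assms(2)
proof (induction n rule: dec_induct)
  case base
  show ?case by (simp add: assms(1))
next
  case (step n)
  then show ?case by simp
qed

lemma aluthge_intertwine:
  assumes T: "clinear_op T" and l: "0 \<le> l" "l \<le> 1"
  shows "aluthge l T o\<^sub>L op_powr (op_abs T) l = op_powr (op_abs T) l o\<^sub>L T"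
proof -
  have pos: "positive_op (op_abs T)" by (rule positive_op_abs[OF T])
  have "op_powr (op_abs T) (1 - l) o\<^sub>L op_powr (op_abs T) l = op_abs T"
    using op_powr_add[OF pos, of "1 - l" l] l op_powr_one[OF pos] by simp
  then show ?thesis
    unfolding aluthge_def by (simp add: blinfun_compose_assoc polar_isometry(1)[OF T])
qed

text \<open>For \<open>l < 1\<close> the rightmost factor vanishes on the kernel of \<open>|T|\<close>. For \<open>l = 1\<close> that factor
  is the identity, and the partial isometry vanishes there.\<close>

lemma aluthge_kernel:
  assumes T: "clinear_op T" and l: "0 < l" "l \<le> 1" and x: "op_abs T x = 0"
  shows "aluthge l T x = 0"
proof (cases "l = 1")
  case True
  have "polar_isometry T x = 0"
    using polar_isometry(2)[OF T] x unfolding op_ker_def by blast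
  then show ?thesis
    by (simp add: aluthge_def True op_powr_zero[OF positive_op_abs[OF T]])
next
  case False
  then have "op_powr (op_abs T) (1 - l) x = 0"
    using l by (intro op_powr_kernel positive_op_abs T x) simp
  then show ?thesis by (simp add: aluthge_def)
qed

theorem theorem4p1:
  fixes T :: "'a::complex_hilbert \<Rightarrow>\<^sub>L 'a" and l :: real and n :: nat
  assumes "clinear_op T" and "0 < l" and "l \<le> 1" and "1 \<le> n"
  shows "n_power_quasinormal n T \<longleftrightarrow> op_power (aluthge l T) n = op_power T n"
proof -
  let ?A = "op_abs T" and ?P = "op_adj T o\<^sub>L T" and ?D = "aluthge l T" and ?N = "op_power T n"
  note T = assms(1)
  have A: "positive_op ?A" by (rule positive_op_abs[OF T])
  have P: "positive_op ?P" by (rule positive_adj_compose[OF T])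
  have sa: "self_adjoint ?A" using A unfolding positive_op_def by blast
  have intertwine: "op_power ?D n o\<^sub>L op_powr ?A l = op_powr ?A l o\<^sub>L ?N"
    using assms by (intro op_power_intertwine aluthge_intertwine) auto
  show ?thesis
  proof
    assume "n_power_quasinormal n T"
    then have "?N o\<^sub>L ?P = ?P o\<^sub>L ?N" unfolding n_power_quasinormal_def .
    then have "?N o\<^sub>L ?A = ?A o\<^sub>L ?N"
      unfolding op_abs_def by (intro op_powr_commute P) simp_all
    then have comm: "?N o\<^sub>L op_powr ?A l = op_powr ?A l o\<^sub>L ?N"
      using assms(2) by (intro op_powr_commute A) simp_all
    have A_eq: "op_powr ?A l o\<^sub>L op_powr ?A (1 - l) = ?A"
      using op_powr_add[OF A, of l "1 - l"] assms op_powr_one[OF A] by simp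
    show "op_power ?D n = ?N"
    proof (rule eq_on_range_and_kernel_imp_eq[OF sa])
      have "op_power ?D n o\<^sub>L ?A = (op_power ?D n o\<^sub>L op_powr ?A l) o\<^sub>L op_powr ?A (1 - l)"
        by (simp only: A_eq blinfun_compose_assoc)
      also have "\<dots> = (?N o\<^sub>L op_powr ?A l) o\<^sub>L op_powr ?A (1 - l)"
        by (simp only: intertwine comm)
      also have "\<dots> = ?N o\<^sub>L ?A" by (simp only: A_eq blinfun_compose_assoc)
      finally show "op_power ?D n o\<^sub>L ?A = ?N o\<^sub>L ?A" .
      fix w assume w: "?A w = 0"
      then have "T w = 0" using norm_op_abs[OF T, of w] by simp
      then show "op_power ?D n w = ?N w"
        using op_power_kernel[OF _ assms(4)] aluthge_kernel[OF T assms(2,3) w] by metis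
    qed
  next
    assume "op_power ?D n = ?N"
    then have "?N o\<^sub>L op_powr ?A l = op_powr ?A l o\<^sub>L ?N" using intertwine by simp
    then have comm: "?N o\<^sub>L ?A = ?A o\<^sub>L ?N"
      by (rule commute_if_commute_op_powr[OF A assms(2)])
    have "?N o\<^sub>L (?A o\<^sub>L ?A) = (?A o\<^sub>L ?A) o\<^sub>L ?N"
      by (metis comm blinfun_compose_assoc)
    then show "n_power_quasinormal n T"
      unfolding n_power_quasinormal_def op_abs_square[OF T] .
  qed
qed

end
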